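(* Let $n\ge 12$ be an integer divisible by $6$, and let $I_n\subseteq \mathbb{C}[x,y,z]$ be the homogeneous defining (radical) ideal of the set $\mathcal{B}_n\subset\mathbb{P}^2_{\mathbb{C}}$ of triple points of the Böröczky configuration of size $n$. Then $\alpha(I_n^{(3)})=n$, and the degree $n$ graded piece $(I_n^{(3)})_n$ is a one-dimensional $\mathbb{C}$-vector space generated by the product of the linear forms defining all $n$ configuration lines: $$(I_n^{(3)})_n=\operatorname{span}_{\mathbb{C}}\Big\{\prod_{L\in\mathcal{L}_n} L\Big\}.$$ Furthermore, $(I_n^{(3)})_n$ is, under the action of $D_6$ on $\mathbb{C}[x,y,z]$, the alternating-sign representation of $D_6$ (rotations act trivially, reflections act by $-1$).
   Context: Böröczky configuration. For a real number $\theta$ let $P_\theta=(\cos\theta,\sin\theta)$ be the point of the unit circle in $\mathbb{R}^2$ with angle $\theta$. For $n\ge 3$ and $0\le j\le n-1$, let $L_j$ be the line through $P_{2\pi j/n}$ and $P_{\pi-4\pi j/n}$ if these points are distinct, and the tangent line to the unit circle at $P_{2\pi j/n}$ if they coincide. Let $\mathcal{L}_n=\{L_j: 0\le j\le n-1\}$ (this consists of $n$ distinct lines). A triple point is a point of the plane where exactly three lines of $\mathcal{L}_n$ meet; $\mathcal{B}_n$ denotes the set of triple points, viewed in $\mathbb{P}^2_{\mathbb{C}}$ via $(a,b)\mapsto[a:b:1]$. The same symbol $L$ denotes a line and a linear form in $\mathbb{C}[x,y,z]$ defining (the projective closure of) it. $I_n^{(3)}$ is the third symbolic power of $I_n$,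 i.e. the ideal generated by the forms vanishing to order at least $3$ at every point of $\mathcal{B}_n$. For a nonzero homogeneous ideal $J$, $\alpha(J)$ is the smallest degree of a nonzero element of $J$. $D_6$ is the dihedral group of order $6$, realized as the subgroup of $GL_3(\mathbb{C})$ generated by the rotation $(x,y,z)\mapsto(\cos\frac{2\pi}{3}x-\sin\frac{2\pi}{3}y,\ \sin\frac{2\pi}{3}x+\cos\frac{2\pi}{3}y,\ z)$ and the reflection $(x,y,z)\mapsto(x,-y,z)$; it acts on $\mathbb{C}[x,y,z]$ by $g\cdot f=f\circ g^{-1}$. *)

theory Defs
  imports
    "HOL-Analysis.Analysis"
    "HOL-Library.Poly_Mapping"
    "HOL-Library.Numeral_Type"
    "HOL-Algebra.Generated_Groups"
begin

section \<open>The polynomial ring $\mathbb{C}[x,y,z]$\<close>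

text \<open>
  A monomial is its exponent vector; the variables $x$, $y$, $z$ carry the indices
  1, 2, 3 of type 3 (in which 3 = 0), in accordance with the components of
  vectors of type complex^3.
\<close>

type_synonym mon3 = "3 \<Rightarrow>\<^sub>0 nat"
type_synonym poly3 = "mon3 \<Rightarrow>\<^sub>0 complex"

definition pconst :: "complex \<Rightarrow> poly3" where
  "pconst c = Poly_Mapping.single 0 c"

definition pvar :: "3 \<Rightarrow> poly3" where
  "pvar i = Poly_Mapping.single (Poly_Mapping.single i 1) 1"

definition mdeg :: "mon3 \<Rightarrow> nat" where
  "mdeg m = (\<Sum>i\<in>UNIV. Poly_Mapping.lookup m i)"

definition total_degree :: "poly3 \<Rightarrow> nat" where
  "total_degree f = Max (insert 0 (mdeg ` Poly_Mapping.keys f))"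

definition homogeneous :: "nat \<Rightarrow> poly3 \<Rightarrow> bool" where
  "homogeneous d f \<longleftrightarrow> (\<forall>m\<in>Poly_Mapping.keys f. mdeg m = d)"

definition peval :: "poly3 \<Rightarrow> complex^3 \<Rightarrow> complex" where
  "peval f v = (\<Sum>m\<in>Poly_Mapping.keys f.
     Poly_Mapping.lookup f m * (\<Prod>i\<in>UNIV. (v $ i) ^ Poly_Mapping.lookup m i))"

definition psubst :: "(3 \<Rightarrow> poly3) \<Rightarrow> poly3 \<Rightarrow> poly3" where
  "psubst s f = (\<Sum>m\<in>Poly_Mapping.keys f.
     pconst (Poly_Mapping.lookup f m) * (\<Prod>i\<in>UNIV. s i ^ Poly_Mapping.lookup m i))"

definition pscale :: "complex \<Rightarrow> poly3 \<Rightarrow> poly3" where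
  "pscale c f = pconst c * f"

global_interpretation cvec: vector_space pscale
  defines cspan = cvec.span and cdim = cvec.dim
  by unfold_locales
    (simp_all add: pscale_def pconst_def algebra_simps single_add mult_single
      flip: mult.assoc)

global_interpretation ring_mod: module "(*) :: poly3 \<Rightarrow> poly3 \<Rightarrow> poly3"
  defines ideal_gen = ring_mod.span
  by unfold_locales (simp_all add: algebra_simps)

definition graded_piece :: "nat \<Rightarrow> poly3 set \<Rightarrow> poly3 set" where
  "graded_piece d J = {f \<in> J. homogeneous d f}"

definition alpha :: "poly3 set \<Rightarrow> nat" where
  "alpha J = (LEAST d. \<exists>f\<in>J. f \<noteq> 0 \<and> total_degree f = d)"

section \<open>Projective points and symbolic powers\<close>

text \<open>A point of $\mathbb{P}^2_{\mathbb{C}}$ is the set of all its homogeneous coordinate vectors.\<close>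

definition proj_point :: "complex^3 \<Rightarrow> (complex^3) set" where
  "proj_point v = {c *s v | c. c \<noteq> 0}"

text \<open>
  The Taylor expansion of \<open>f\<close> at \<open>p\<close>, i.e. the polynomial $f(p + (x,y,z))$, has no terms of
  degree below \<open>m\<close>.
\<close>

definition order_ge :: "nat \<Rightarrow> poly3 \<Rightarrow> complex^3 \<Rightarrow> bool" where
  "order_ge m f p \<longleftrightarrow>
     (\<forall>k\<in>Poly_Mapping.keys (psubst (\<lambda>i. pconst (p $ i) + pvar i) f). m \<le> mdeg k)"

text \<open>
  For a finite set \<open>Z\<close> of projective points with radical ideal $I$ this is the symbolic
  power $I^{(m)}$; in particular $m = 1$ gives $I$ itself.
\<close>

definition symbolic_power :: "(complex^3) set set \<Rightarrow> nat \<Rightarrow> poly3 set" where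
  "symbolic_power Z m =
     ideal_gen {f. (\<exists>d. homogeneous d f) \<and> (\<forall>P\<in>Z. \<forall>p\<in>P. order_ge m f p)}"

section \<open>The Boroczky configuration\<close>

definition circle_pt :: "real \<Rightarrow> real \<times> real" where
  "circle_pt t = (cos t, sin t)"

definition boroczky_line :: "nat \<Rightarrow> nat \<Rightarrow> (real \<times> real) set" where
  "boroczky_line n j =
     (let P = circle_pt (2 * pi * real j / real n);
          Q = circle_pt (pi - 4 * pi * real j / real n)
      in if P \<noteq> Q then affine hull {P, Q} else {X. (X - P) \<bullet> P = 0})"

definition boroczky_lines :: "nat \<Rightarrow> (real \<times> real) set set" where
  "boroczky_lines n = boroczky_line n ` {0..<n}"

definition affine_pt :: "real \<times> real \<Rightarrow> complex^3" where
  "affine_pt X = vector [complex_of_real (fst X), complex_of_real (snd X), 1]"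

definition triple_points :: "nat \<Rightarrow> (complex^3) set set" where
  "triple_points n =
     (\<lambda>X. proj_point (affine_pt X)) ` {X. card {L \<in> boroczky_lines n. X \<in> L} = 3}"

text \<open>
  A complex linear form whose real zeros in the chart $z = 1$ are exactly the points of a line
  is determined by the line up to a nonzero scalar, and its zero set in
  $\mathbb{P}^2_{\mathbb{C}}$ is the projective closure of that line.
\<close>

definition defines_line :: "poly3 \<Rightarrow> (real \<times> real) set \<Rightarrow> bool" where
  "defines_line l L \<longleftrightarrow> homogeneous 1 l \<and> {X. peval l (affine_pt X) = 0} = L"

section \<open>The dihedral group of order 6\<close>

definition GL3 :: "(complex^3^3) monoid" where
  "GL3 = \<lparr>carrier = {A. invertible A}, mult = (**), one = mat 1\<rparr>"

definition rot_mat :: "complex^3^3" where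
  "rot_mat = (let c = complex_of_real (cos (2 * pi / 3)); s = complex_of_real (sin (2 * pi / 3))
     in vector [vector [c, - s, 0], vector [s, c, 0], vector [0, 0, 1]])"

definition refl_mat :: "complex^3^3" where
  "refl_mat = vector [vector [1, 0, 0], vector [0, - 1, 0], vector [0, 0, 1]]"

definition D6 :: "(complex^3^3) set" where
  "D6 = generate GL3 {rot_mat, refl_mat}"

definition D6_rotations :: "(complex^3^3) set" where
  "D6_rotations = generate GL3 {rot_mat}"

text \<open>$g \cdot f = f \circ g^{-1}$\<close>

definition act :: "complex^3^3 \<Rightarrow> poly3 \<Rightarrow> poly3" where
  "act g f = psubst (\<lambda>i. \<Sum>j\<in>UNIV. pconst (matrix_inv g $ i $ j) * pvar j) f"

end

theory Submission
  imports Defs "HOL-Computational_Algebra.Polynomial"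
begin

text \<open>
  With $t = \pi j/n$ the line $L_j$ is $x \sin t + y \cos t = \sin 3t$. Parametrizing it by arc
  length from the foot of the perpendicular, the line with angle $u$ meets it at the parameter
  $\cos 3t + 2\cos(t + 2u)$; hence $L_i, L_j, L_k$ are concurrent iff $n$ divides $i + j + k$.

  Let $f$ be a form of degree at most $n$ vanishing to order 3 at all triple points. Restricted to
  a line $L_i$ with $i$ odd, $f$ has $(n-2)/2$ roots of multiplicity 3, more than its degree allows,
  so $f$ is divisible by all these lines. The cofactor has degree at most $n/2$; on a line $L_i$
  with $i$ even it still vanishes to order 1 at the triple points lying on two odd lines and to
  order 3 at those lying on none, which again is too much. So all $n$ linear forms divide $f$.

  The dihedral action permutes the forms $\sin t\, x + \cos t\, y - \sin 3t\, z$ by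
  $t \mapsto t - 2\pi k/3$ and $t \mapsto \pi - t - 2\pi k/3$; since $t \mapsto t + \pi$ changes
  the sign of such a form, shifting the index $j$ by one changes the sign of their product.
\<close>

section \<open>Polynomials in three variables\<close>

locale ring_morphism =
  fixes h :: "'a::comm_ring_1 \<Rightarrow> 'b::comm_ring_1"
  assumes one [simp]: "h 1 = 1"
    and add [simp]: "h (a + b) = h a + h b"
    and mult [simp]: "h (a * b) = h a * h b"
begin

lemma zero [simp]: "h 0 = 0"
  using add[of 0 0] by simp

lemma uminus [simp]: "h (- a) = - h a"
  using add[of a "- a"] by (simp add: eq_neg_iff_add_eq_0 add.commute)

lemma diff [simp]: "h (a - b) = h a - h b"
  using add[of a "- b"] by simp

lemma sum [simp]: "h (sum f A) = (\<Sum>x\<in>A. h (f x))"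
  by (induction A rule: infinite_finite_induct) auto

lemma prod [simp]: "h (prod f A) = (\<Prod>x\<in>A. h (f x))"
  by (induction A rule: infinite_finite_induct) auto

end

lemma ring_morphism_pconst: "ring_morphism pconst"
  by unfold_locales (simp_all add: pconst_def single_add mult_single)

interpretation pconst: ring_morphism pconst
  by (rule ring_morphism_pconst)

text \<open>The exponent vector is the sum of its one-variable parts, and
  \<open>Poly_Mapping.single\<close> turns sums of exponents into products. Hence constants and
  variables generate the ring.\<close>

lemma single_expand:
  "Poly_Mapping.single m c = pconst c * (\<Prod>i\<in>UNIV. pvar i ^ Poly_Mapping.lookup m i)"
proof -
  have pow: "pvar i ^ k = Poly_Mapping.single (Poly_Mapping.single i k) 1" for i k
    by (induction k) (simp_all add: pvar_def mult_single flip: single_add)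
  have prd: "(\<Prod>i\<in>A. Poly_Mapping.single (g i) (1::complex)) = Poly_Mapping.single (\<Sum>i\<in>A. g i) 1"
    if "finite A" for A and g :: "3 \<Rightarrow> mon3"
    using that by (induction A) (simp_all add: mult_single)
  have "(\<Sum>i\<in>UNIV. Poly_Mapping.single i (Poly_Mapping.lookup m i)) = m"
    by (rule poly_mapping_eqI) (simp add: lookup_sum lookup_single when_def)
  then show ?thesis
    by (simp add: pow prd pconst_def mult_single)
qed

text \<open>Every polynomial is the finite sum of its terms; the empty sum is the term with
  coefficient 0.\<close>

lemma poly3_induct [case_names single add]:
  assumes "\<And>m c. P (Poly_Mapping.single m c)" and "\<And>f g. P f \<Longrightarrow> P g \<Longrightarrow> P (f + g)"
  shows "P (f :: poly3)"
proof -
  have *: "P (\<Sum>m\<in>A. Poly_Mapping.single m (Poly_Mapping.lookup f m))" if "finite A" for A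
    using that
  proof (induction A)
    case empty
    then show ?case using assms(1)[of 0 0] by simp
  qed (simp add: assms)
  have "(\<Sum>m\<in>Poly_Mapping.keys f. Poly_Mapping.single m (Poly_Mapping.lookup f m)) = f"
    by (rule poly_mapping_eqI) (simp add: lookup_sum lookup_single when_def in_keys_iff)
  with *[of "Poly_Mapping.keys f"] show ?thesis by simp
qed

lemma poly3_ring_induct [case_names const var add mult]:
  assumes const: "\<And>c. P (pconst c)" and var: "\<And>i. P (pvar i)"
    and add: "\<And>f g. P f \<Longrightarrow> P g \<Longrightarrow> P (f + g)"
    and mult: "\<And>f g. P f \<Longrightarrow> P g \<Longrightarrow> P (f * g)"
  shows "P (f :: poly3)"
proof (induction f rule: poly3_induct)
  case (single m c)
  have one: "P 1" using const[of 1] by simp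
  have pow: "P (pvar i ^ k)" for i k
    by (induction k) (auto intro: var mult one)
  have prd: "P (\<Prod>i\<in>A. pvar i ^ Poly_Mapping.lookup m i)" if "finite A" for A
    using that by (induction A) (auto intro: one mult pow)
  show ?case unfolding single_expand by (intro mult const prd) simp
qed (rule add)

text \<open>Constants and variables generate the ring. Identities between composed evaluations thus
  need no expansion of sums.\<close>

lemma ring_morphism_ext:
  assumes "ring_morphism h" and "ring_morphism k"
    and "\<And>c. h (pconst c) = k (pconst c)" and "\<And>i. h (pvar i) = k (pvar i)"
  shows "h (f :: poly3) = k f"
  by (induction f rule: poly3_ring_induct)
     (simp_all add: assms ring_morphism.add ring_morphism.mult)

lemma prod_UNIV_3: "prod f (UNIV :: 3 set) = f 1 * f 2 * (f 3 :: 'a::comm_monoid_mult)"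
  unfolding UNIV_3 by (simp add: mult.assoc)

section \<open>Evaluation morphisms\<close>

lemma ring_morphism_comp:
  "ring_morphism h \<Longrightarrow> ring_morphism k \<Longrightarrow> ring_morphism (\<lambda>x. h (k x))"
  by (simp add: ring_morphism_def)

text \<open>Common form of \<open>peval\<close>, \<open>psubst\<close> and the substitution of
  univariate polynomials, which differ only in how coefficients are embedded by \<open>c\<close>;
  multiplicativity is then proved once.\<close>

definition aeval :: "(complex \<Rightarrow> 'a::comm_ring_1) \<Rightarrow> (3 \<Rightarrow> 'a) \<Rightarrow> poly3 \<Rightarrow> 'a" where
  "aeval c s f = (\<Sum>m\<in>Poly_Mapping.keys f.
     c (Poly_Mapping.lookup f m) * (\<Prod>i\<in>UNIV. s i ^ Poly_Mapping.lookup m i))"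

lemma psubst_eq_aeval: "psubst = aeval pconst"
  by (simp add: fun_eq_iff psubst_def aeval_def)

lemma peval_eq_aeval: "peval f v = aeval (\<lambda>c. c) (($) v) f"
  by (simp add: peval_def aeval_def)

context
  fixes c :: "complex \<Rightarrow> 'a::comm_ring_1"
  assumes c: "ring_morphism c"
begin

interpretation c: ring_morphism c by (rule c)

lemma aeval_single:
  "aeval c s (Poly_Mapping.single m a) = c a * (\<Prod>i\<in>UNIV. s i ^ Poly_Mapping.lookup m i)"
  by (simp add: aeval_def)

lemma aeval_pconst [simp]: "aeval c s (pconst a) = c a"
  by (simp add: pconst_def aeval_single)

lemma aeval_pvar [simp]: "aeval c s (pvar i) = s i"
proof -
  have "(\<Prod>j\<in>UNIV. s j ^ Poly_Mapping.lookup (Poly_Mapping.single i 1) j) =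
      (\<Prod>j\<in>UNIV. if j = i then s j else 1)"
    by (rule prod.cong) (auto simp: lookup_single when_def)
  then show ?thesis by (simp add: pvar_def aeval_single)
qed

lemma aeval_add: "aeval c s (f + g) = aeval c s f + aeval c s g"
  unfolding aeval_def
  by (rule setsum_keys_plus_distrib) (simp_all add: algebra_simps)

lemma aeval_mult: "aeval c s (f * g) = aeval c s f * aeval c s g"
proof (induction f rule: poly3_induct)
  case (single m a)
  show ?case
    by (induction g rule: poly3_induct)
       (simp_all add: aeval_single aeval_add mult_single lookup_add power_add prod.distrib
         algebra_simps)
qed (simp add: aeval_add algebra_simps)

lemma ring_morphism_aeval: "ring_morphism (aeval c s)"
proof
  show "aeval c s 1 = 1" using aeval_pconst[of s 1] by simp
qed (simp_all add: aeval_add aeval_mult)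

end

lemma ring_morphism_poly_const: "ring_morphism (\<lambda>c::complex. [:c:])"
  by unfold_locales (simp_all add: one_pCons)

lemma ring_morphism_ident: "ring_morphism (\<lambda>c. c)"
  by unfold_locales simp_all

lemma ring_morphism_poly: "ring_morphism (\<lambda>p::complex poly. poly p x)"
  by unfold_locales simp_all

lemma poly_aeval: "poly (aeval (\<lambda>c. [:c:]) w f) x = aeval (\<lambda>c. c) (\<lambda>i. poly (w i) x) f"
  by (rule ring_morphism_ext)
     (simp_all add: ring_morphism_comp[OF ring_morphism_poly] ring_morphism_aeval
       ring_morphism_poly_const ring_morphism_ident)

lemma aeval_psubst:
  assumes "ring_morphism c"
  shows "aeval c s (psubst t f) = aeval c (\<lambda>i. aeval c s (t i)) f"
  unfolding psubst_eq_aeval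
  by (rule ring_morphism_ext)
     (simp_all add: assms ring_morphism_comp ring_morphism_aeval ring_morphism_pconst)

text \<open>Modulo \<open>l\<close> the substitution fixes all variables, hence every polynomial. It
  is applied with \<open>s\<close> a linear projection onto the plane where \<open>l\<close>
  vanishes.\<close>

lemma dvd_diff_psubst:
  assumes "\<And>i. l dvd pvar i - s i"
  shows "l dvd f - psubst s f"
proof (induction f rule: poly3_ring_induct)
  case (mult f g)
  have "f * g - psubst s (f * g) = (f - psubst s f) * g + psubst s f * (g - psubst s g)"
    by (simp add: psubst_eq_aeval aeval_mult ring_morphism_pconst algebra_simps)
  with mult show ?case by simp
next
  case (add f g)
  have "f + g - psubst s (f + g) = (f - psubst s f) + (g - psubst s g)"
    by (simp add: psubst_eq_aeval aeval_add ring_morphism_pconst)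
  with add show ?case by (metis dvd_add)
qed (simp_all add: psubst_eq_aeval ring_morphism_pconst assms)

text \<open>Kronecker substitution: $(x, x^N, x^{N^2})$ separates monomials with exponents below $N$.\<close>

lemma poly3_eq_0I:
  assumes "\<And>v. aeval (\<lambda>c. c) v f = 0"
  shows "f = 0"
proof (rule ccontr)
  assume "f \<noteq> 0"
  then obtain m0 where m0: "m0 \<in> Poly_Mapping.keys f"
    unfolding poly_mapping_eq_iff fun_eq_iff lookup_zero in_keys_iff by blast
  obtain N where N: "\<And>m i. m \<in> Poly_Mapping.keys f \<Longrightarrow> Poly_Mapping.lookup m i < N"
  proof -
    let ?E = "\<Union>m\<in>Poly_Mapping.keys f. range (Poly_Mapping.lookup m)"
    have "finite ?E" by simp
    then obtain N where "\<forall>k\<in>?E. k < N"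
      using finite_nat_set_iff_bounded by blast
    then show ?thesis by (intro that) blast
  qed
  define code where "code m = Poly_Mapping.lookup m 1 + N * (Poly_Mapping.lookup m 2 + N * Poly_Mapping.lookup m 3)"
    for m :: mon3
  have inj: "m = m0" if m: "m \<in> Poly_Mapping.keys f" and eq: "code m = code m0" for m
  proof (rule poly_mapping_eqI)
    note lt = N[OF m] N[OF m0]
    have split: "a = a' \<and> b = b'" if "a + N * b = a' + N * b'" "a < N" "a' < N" for a b a' b' :: nat
    proof -
      have "(a + N * b) mod N = a" "(a + N * b) div N = b" using that(2) by auto
      moreover have "(a' + N * b') mod N = a'" "(a' + N * b') div N = b'" using that(3) by auto
      ultimately show ?thesis using that(1) by simp
    qed
    have "Poly_Mapping.lookup m 1 = Poly_Mapping.lookup m0 1 \<and>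
      Poly_Mapping.lookup m 2 + N * Poly_Mapping.lookup m 3 = Poly_Mapping.lookup m0 2 + N * Poly_Mapping.lookup m0 3"
      using eq lt unfolding code_def by (intro split) auto
    moreover from this have "Poly_Mapping.lookup m 2 = Poly_Mapping.lookup m0 2 \<and>
      Poly_Mapping.lookup m 3 = Poly_Mapping.lookup m0 3"
      using lt by (intro split) auto
    ultimately show "Poly_Mapping.lookup m i = Poly_Mapping.lookup m0 i" for i
      using exhaust_3[of i] by auto
  qed
  define w :: "3 \<Rightarrow> complex poly" where
    "w i = monom 1 (if i = 1 then 1 else if i = 2 then N else N * N)" for i
  have "(\<Prod>i\<in>UNIV. w i ^ Poly_Mapping.lookup m i) = monom 1 (code m)" for m
    by (simp add: prod_UNIV_3 w_def monom_power mult_monom code_def distrib_left mult.assoc add.assoc)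
  then have "aeval (\<lambda>c. [:c:]) w f = (\<Sum>m\<in>Poly_Mapping.keys f. monom (Poly_Mapping.lookup f m) (code m))"
    by (simp add: aeval_def smult_monom)
  then have "coeff (aeval (\<lambda>c. [:c:]) w f) (code m0) =
      (\<Sum>m\<in>Poly_Mapping.keys f. if code m = code m0 then Poly_Mapping.lookup f m else 0)"
    by (simp add: coeff_sum)
  also have "\<dots> = (\<Sum>m\<in>Poly_Mapping.keys f. if m = m0 then Poly_Mapping.lookup f m else 0)"
    by (rule sum.cong) (use inj in auto)
  also have "\<dots> = Poly_Mapping.lookup f m0" using m0 by simp
  also have "\<dots> \<noteq> 0" using m0 by (simp add: in_keys_iff)
  finally have "aeval (\<lambda>c. [:c:]) w f \<noteq> 0" by auto
  moreover have "poly (aeval (\<lambda>c. [:c:]) w f) x = 0" for x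
    using assms by (simp add: poly_aeval)
  ultimately show False using poly_all_0_iff_0 by blast
qed

section \<open>Homogeneous forms and homogeneous components\<close>

lemma mdeg_0 [simp]: "mdeg 0 = 0"
  by (simp add: mdeg_def)

lemma mdeg_add [simp]: "mdeg (a + b) = mdeg a + mdeg b"
  by (simp add: mdeg_def lookup_add sum.distrib)

lemma mdeg_single [simp]: "mdeg (Poly_Mapping.single i k) = k"
  by (simp add: mdeg_def lookup_single when_def)

lemma homogeneous_add: "homogeneous d f \<Longrightarrow> homogeneous d g \<Longrightarrow> homogeneous d (f + g)"
  using keys_add[of f g] by (auto simp: homogeneous_def)

lemma homogeneous_uminus: "homogeneous d f \<Longrightarrow> homogeneous d (- f)"
  by (simp add: homogeneous_def in_keys_iff)

lemma homogeneous_diff: "homogeneous d f \<Longrightarrow> homogeneous d g \<Longrightarrow> homogeneous d (f - g)"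
  using homogeneous_add[of d f "- g"] homogeneous_uminus[of d g] by simp

lemma homogeneous_mult: "homogeneous d f \<Longrightarrow> homogeneous e g \<Longrightarrow> homogeneous (d + e) (f * g)"
  using keys_mult[of f g] by (fastforce simp: homogeneous_def)

lemma homogeneous_pconst: "homogeneous 0 (pconst c)"
  by (simp add: homogeneous_def pconst_def)

lemma homogeneous_pvar: "homogeneous 1 (pvar i)"
  by (simp add: homogeneous_def pvar_def)

lemma homogeneous_pconst_mult: "homogeneous d f \<Longrightarrow> homogeneous d (pconst c * f)"
  using homogeneous_mult[OF homogeneous_pconst] by simp

lemma homogeneous_prod:
  assumes "\<And>x. x \<in> A \<Longrightarrow> homogeneous 1 (f x)"
  shows "homogeneous (card A) (\<Prod>x\<in>A. f x)"
  using assms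
proof (induction A rule: infinite_finite_induct)
  case (insert x A)
  then show ?case using homogeneous_mult[of 1 "f x" "card A"] by simp
qed (use homogeneous_pconst[of 1] in simp_all)

lemma homogeneous_0_imp_pconst:
  assumes "homogeneous 0 f"
  obtains c where "f = pconst c"
proof
  have *: "m = 0" if "mdeg m = 0" for m :: mon3
    using that by (auto simp: mdeg_def intro: poly_mapping_eqI)
  show "f = pconst (Poly_Mapping.lookup f 0)"
  proof (intro poly_mapping_eqI)
    fix m
    show "Poly_Mapping.lookup f m = Poly_Mapping.lookup (pconst (Poly_Mapping.lookup f 0)) m"
    proof (cases "m = 0")
      case False
      then have "m \<notin> Poly_Mapping.keys f"
        using assms * by (auto simp: homogeneous_def)
      then show ?thesis using False by (simp add: pconst_def lookup_single in_keys_iff)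
    qed (simp add: pconst_def)
  qed
qed

lemma aeval_homogeneous_scale:
  assumes "homogeneous d f"
  shows "aeval (\<lambda>c. c) (\<lambda>i. a * v i) f = a ^ d * aeval (\<lambda>c. c) v f"
  unfolding aeval_def sum_distrib_left
proof (rule sum.cong)
  fix m assume "m \<in> Poly_Mapping.keys f"
  then have "mdeg m = d" using assms by (simp add: homogeneous_def)
  then have "(\<Prod>i\<in>UNIV. a ^ Poly_Mapping.lookup m i) = a ^ d"
    by (auto simp: mdeg_def power_sum)
  then show "Poly_Mapping.lookup f m * (\<Prod>i\<in>UNIV. (a * v i) ^ Poly_Mapping.lookup m i) =
      a ^ d * (Poly_Mapping.lookup f m * (\<Prod>i\<in>UNIV. v i ^ Poly_Mapping.lookup m i))"
    by (simp add: power_mult_distrib prod.distrib)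
qed simp

lemma degree_aeval_le:
  assumes "homogeneous d f" and "\<And>i. degree (w i) \<le> 1"
  shows "degree (aeval (\<lambda>c. [:c:]) w f :: complex poly) \<le> d"
  unfolding aeval_def
proof (rule degree_sum_le)
  fix m assume "m \<in> Poly_Mapping.keys f"
  then have m: "mdeg m = d" using assms(1) by (simp add: homogeneous_def)
  have "degree (\<Prod>i\<in>UNIV. w i ^ Poly_Mapping.lookup m i) \<le> (\<Sum>i\<in>UNIV. degree (w i ^ Poly_Mapping.lookup m i))"
    by (rule degree_prod_sum_le[unfolded o_def]) simp
  also have "\<dots> \<le> (\<Sum>i\<in>UNIV. Poly_Mapping.lookup m i)"
  proof (rule sum_mono)
    fix i
    have "degree (w i ^ Poly_Mapping.lookup m i) \<le> degree (w i) * Poly_Mapping.lookup m i"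
      by (rule degree_power_le)
    also have "\<dots> \<le> 1 * Poly_Mapping.lookup m i"
      using assms(2)[of i] by (rule mult_right_mono) simp
    finally show "degree (w i ^ Poly_Mapping.lookup m i) \<le> Poly_Mapping.lookup m i" by simp
  qed
  also have "\<dots> = d" using m by (simp add: mdeg_def)
  finally show "degree ([:Poly_Mapping.lookup f m:] * (\<Prod>i\<in>UNIV. w i ^ Poly_Mapping.lookup m i)) \<le> d"
    by (simp add: le_trans[OF degree_smult_le])
qed simp

definition hcomp :: "nat \<Rightarrow> poly3 \<Rightarrow> poly3" where
  "hcomp d f = Poly_Mapping.mapp (\<lambda>m c. if mdeg m = d then c else 0) f"

lemma lookup_hcomp:
  "Poly_Mapping.lookup (hcomp d f) m = (if mdeg m = d then Poly_Mapping.lookup f m else 0)"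
  by (simp add: hcomp_def lookup_mapp when_def in_keys_iff)

lemma homogeneous_hcomp: "homogeneous d (hcomp d f)"
  unfolding homogeneous_def by (intro ballI) (metis in_keys_iff lookup_hcomp)

lemma hcomp_0 [simp]: "hcomp d 0 = 0"
  by (rule poly_mapping_eqI) (simp add: lookup_hcomp)

lemma hcomp_add: "hcomp d (f + g) = hcomp d f + hcomp d g"
  by (rule poly_mapping_eqI) (simp add: lookup_hcomp lookup_add)

lemma hcomp_homogeneous:
  "homogeneous e f \<Longrightarrow> hcomp d f = (if d = e then f else 0)"
  by (rule poly_mapping_eqI) (auto simp: lookup_hcomp homogeneous_def in_keys_iff)

text \<open>By additivity \<open>f\<close> may be taken to be a single term, whose product with
  \<open>a\<close> is again homogeneous.\<close>

lemma hcomp_mult_homogeneous: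
  assumes "homogeneous e a"
  shows "hcomp d (f * a) = (if e \<le> d then hcomp (d - e) f * a else 0)"
proof (induction f rule: poly3_induct)
  case (single m c)
  have s: "homogeneous (mdeg m) (Poly_Mapping.single m c)" by (simp add: homogeneous_def)
  show ?case
    using hcomp_homogeneous[OF s] hcomp_homogeneous[OF homogeneous_mult[OF s assms]] by auto
qed (simp add: hcomp_add algebra_simps)

text \<open>Only the component of degree \<open>d - e\<close> of an arbitrary cofactor contributes
  to \<open>f\<close>, so the cofactor can be replaced by that component.\<close>

lemma homogeneous_dvd:
  assumes "homogeneous d f" and "homogeneous e l" and "l dvd f" and "e \<le> d"
  obtains g where "f = l * g" and "homogeneous (d - e) g"
proof -
  from \<open>l dvd f\<close> obtain g where g: "f = g * l" by (metis dvdE mult.commute)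
  have "f = hcomp d f" using assms(1) by (simp add: hcomp_homogeneous)
  also have "\<dots> = hcomp (d - e) g * l"
    using assms by (simp add: g hcomp_mult_homogeneous)
  finally show ?thesis by (intro that[of "hcomp (d - e) g"]) (simp_all add: homogeneous_hcomp mult.commute)
qed

text \<open>A multiple of a form of degree \<open>e\<close> has no components below degree
  \<open>e\<close>.\<close>

lemma homogeneous_dvd_eq_0:
  assumes "homogeneous d f" and "homogeneous e l" and "l dvd f" and "d < e"
  shows "f = 0"
proof -
  from \<open>l dvd f\<close> obtain g where g: "f = g * l" by (metis dvdE mult.commute)
  have "f = hcomp d f" using assms(1) by (simp add: hcomp_homogeneous)
  then show ?thesis using assms by (simp add: g hcomp_mult_homogeneous)
qed

section \<open>Order of vanishing at a point\<close>

definition lowdeg :: "nat \<Rightarrow> poly3 \<Rightarrow> bool" where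
  "lowdeg m f \<longleftrightarrow> (\<forall>k\<in>Poly_Mapping.keys f. m \<le> mdeg k)"

lemma lowdeg_add: "lowdeg m f \<Longrightarrow> lowdeg m g \<Longrightarrow> lowdeg m (f + g)"
  using keys_add[of f g] by (auto simp: lowdeg_def)

lemma lowdeg_mult: "lowdeg m f \<Longrightarrow> lowdeg k g \<Longrightarrow> lowdeg (m + k) (f * g)"
  using keys_mult[of f g] by (fastforce simp: lowdeg_def)

lemma lowdeg_0 [simp]: "lowdeg 0 f" "lowdeg m 0"
  by (simp_all add: lowdeg_def)

lemma homogeneous_imp_lowdeg: "homogeneous m f \<Longrightarrow> lowdeg m f"
  by (simp add: lowdeg_def homogeneous_def)

lemma lowdeg_prod:
  assumes "finite A" and "\<And>x. x \<in> A \<Longrightarrow> lowdeg 1 (f x)"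
  shows "lowdeg (card A) (\<Prod>x\<in>A. f x)"
  using assms
proof (induction A rule: finite_induct)
  case (insert x A)
  then show ?case using lowdeg_mult[of 1 "f x" "card A"] by simp
qed simp

definition pshift :: "complex^3 \<Rightarrow> poly3 \<Rightarrow> poly3" where
  "pshift p = psubst (\<lambda>i. pconst (p $ i) + pvar i)"

lemma order_ge_iff: "order_ge m f p \<longleftrightarrow> lowdeg m (pshift p f)"
  by (simp add: order_ge_def lowdeg_def pshift_def)

interpretation pshift: ring_morphism "pshift p" for p
  by (simp add: pshift_def psubst_eq_aeval ring_morphism_aeval ring_morphism_pconst)

lemma order_ge_zero [simp]: "order_ge m 0 p"
  by (simp add: order_ge_iff)

lemma order_ge_add: "order_ge m f p \<Longrightarrow> order_ge m g p \<Longrightarrow> order_ge m (f + g) p"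
  by (simp add: order_ge_iff lowdeg_add)

lemma order_ge_mult: "order_ge m f p \<Longrightarrow> order_ge m (g * f) p"
  using lowdeg_mult[of 0 _ m] by (simp add: order_ge_iff)

text \<open>Each monomial \<open>k\<close> contributes the factor \<open>X ^ mdeg k\<close>, and
  \<open>mdeg k\<close> is at least \<open>m\<close>.\<close>

lemma lowdeg_imp_power_dvd:
  assumes "lowdeg m f"
  shows "X ^ m dvd aeval c (\<lambda>i. X * u i) f"
  unfolding aeval_def
proof (rule dvd_sum)
  fix k assume "k \<in> Poly_Mapping.keys f"
  then have "m \<le> mdeg k" using assms by (simp add: lowdeg_def)
  moreover have "(\<Prod>i\<in>UNIV. (X * u i) ^ Poly_Mapping.lookup k i) =
      X ^ mdeg k * (\<Prod>i\<in>UNIV. u i ^ Poly_Mapping.lookup k i)"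
    by (simp add: power_mult_distrib prod.distrib mdeg_def power_sum)
  ultimately show "X ^ m dvd c (Poly_Mapping.lookup f k) * (\<Prod>i\<in>UNIV. (X * u i) ^ Poly_Mapping.lookup k i)"
    by (simp add: le_imp_power_dvd)
qed

text \<open>Substituting a curve of the form \<open>p + X * u\<close> into \<open>f\<close> is the
  same as substituting \<open>X * u\<close> into the Taylor expansion at \<open>p\<close>.\<close>

lemma order_ge_imp_dvd:
  assumes "order_ge m f p" and "\<And>i. w i = [:p $ i:] + X * u i"
  shows "X ^ m dvd aeval (\<lambda>c. [:c:]) w f"
proof -
  have "aeval (\<lambda>c. [:c:]) w f = aeval (\<lambda>c. [:c:]) (\<lambda>i. X * u i) (pshift p f)"
    unfolding pshift_def
    by (subst aeval_psubst)
       (simp_all add: ring_morphism_poly_const aeval_add flip: assms(2))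
  also have "X ^ m dvd \<dots>" using assms(1) by (intro lowdeg_imp_power_dvd) (simp add: order_ge_iff)
  finally show ?thesis .
qed

section \<open>The lines and their forms\<close>

definition tri :: "'a \<Rightarrow> 'a \<Rightarrow> 'a \<Rightarrow> 3 \<Rightarrow> 'a" where
  "tri a b c i = (if i = 1 then a else if i = 2 then b else c)"

lemma tri_simps [simp]: "tri a b c 1 = a" "tri a b c 2 = b" "tri a b c 3 = c"
  by (simp_all add: tri_def)

lemma pvar_neq_0: "pvar i \<noteq> 0"
proof
  assume "pvar i = 0"
  then have "Poly_Mapping.lookup (pvar i) (Poly_Mapping.single i 1) = 0" by simp
  then show False by (simp only: pvar_def lookup_single_eq one_neq_zero)
qed

lemma fun_3_eqI: "f 1 = g 1 \<Longrightarrow> f 2 = g 2 \<Longrightarrow> f 3 = g 3 \<Longrightarrow> f = (g :: 3 \<Rightarrow> 'a)"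
  by (metis exhaust_3 ext)

text \<open>The normal vector \<open>(sin t, cos t)\<close> has length 1, so
  \<open>sin (3 * t)\<close> is the signed distance of the line from the origin.\<close>

definition ell :: "real \<Rightarrow> poly3" where
  "ell t = pconst (of_real (sin t)) * pvar 1 + pconst (of_real (cos t)) * pvar 2
     - pconst (of_real (sin (3 * t))) * pvar 3"

definition line_of :: "real \<Rightarrow> (real \<times> real) set" where
  "line_of t = {X. fst X * sin t + snd X * cos t = sin (3 * t)}"

definition line_pt :: "real \<Rightarrow> real \<Rightarrow> real \<times> real" where
  "line_pt t s = (sin (3 * t) * sin t + s * cos t, sin (3 * t) * cos t - s * sin t)"

text \<open>Parameter on the line with angle \<open>t\<close> of its intersection with the line with
  angle \<open>u\<close>, after cancelling \<open>sin (t - u)\<close>. Since \<open>u\<close> enters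
  only through \<open>cos (t + 2 * u)\<close>, comparing two crossings amounts to comparing two
  cosines.\<close>

definition crossing :: "real \<Rightarrow> real \<Rightarrow> real" where
  "crossing t u = cos (3 * t) + 2 * cos (t + 2 * u)"

text \<open>Pullback along \<open>line_pt t\<close> in the chart where the third coordinate is 1;
  the line parameter becomes the polynomial variable.\<close>

definition restr :: "real \<Rightarrow> poly3 \<Rightarrow> complex poly" where
  "restr t = aeval (\<lambda>c. [:c:])
     (tri [:of_real (sin (3 * t) * sin t), of_real (cos t):]
          [:of_real (sin (3 * t) * cos t), - of_real (sin t):] 1)"

lemma homogeneous_ell: "homogeneous 1 (ell t)"
  unfolding ell_def
  by (intro homogeneous_add homogeneous_diff homogeneous_pconst_mult homogeneous_pvar)

lemma aeval_ell:
  assumes "ring_morphism c"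
  shows "aeval c s (ell t) = c (of_real (sin t)) * s 1 + c (of_real (cos t)) * s 2
    - c (of_real (sin (3 * t))) * s 3"
proof -
  interpret ring_morphism "aeval c s" using assms by (rule ring_morphism_aeval)
  show ?thesis using assms by (simp add: ell_def)
qed

lemma restr_morphism: "ring_morphism (restr t)"
  by (simp add: restr_def ring_morphism_aeval ring_morphism_poly_const)

interpretation restr: ring_morphism "restr t" for t
  by (rule restr_morphism)

text \<open>The product-to-sum formulas reduce both sides to sines of \<open>4 * t - u\<close>,
  \<open>2 * t + u\<close> and \<open>3 * u\<close>.\<close>

lemma crossing_identity: "sin (3 * t) * cos (t - u) - sin (3 * u) = sin (t - u) * crossing t (u :: real)"
proof -
  have "sin (3 * t) * cos (t - u) = (sin (4 * t - u) + sin (2 * t + u)) / 2"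
    unfolding sin_times_cos by (simp add: algebra_simps)
  moreover have "sin (t - u) * cos (3 * t) = (sin (4 * t - u) - sin (2 * t + u)) / 2"
    unfolding sin_times_cos using sin_minus[of "2 * t + u"] by (simp add: algebra_simps)
  moreover have "sin (t - u) * cos (t + 2 * u) = (sin (2 * t + u) - sin (3 * u)) / 2"
    unfolding sin_times_cos using sin_minus[of "3 * u"] by (simp add: algebra_simps)
  ultimately show ?thesis by (simp add: crossing_def algebra_simps)
qed

text \<open>This factorization is the source of all incidence statements: two transverse lines meet
  exactly at the parameter \<open>crossing t u\<close>.\<close>

lemma line_pt_eval:
  "fst (line_pt t s) * sin u + snd (line_pt t s) * cos u - sin (3 * u) = sin (u - t) * (s - crossing t u)"
proof -
  have "fst (line_pt t s) * sin u + snd (line_pt t s) * cos u - sin (3 * u) =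
      (sin (3 * t) * cos (t - u) - sin (3 * u)) - s * sin (t - u)"
    by (simp add: line_pt_def cos_diff sin_diff algebra_simps)
  also have "\<dots> = sin (u - t) * (s - crossing t u)"
    unfolding crossing_identity using sin_minus[of "t - u"] by (simp add: algebra_simps)
  finally show ?thesis .
qed

lemma restr_ell:
  "restr t (ell u) = smult (of_real (sin (u - t))) [:- of_real (crossing t u), 1:]"
proof -
  have "sin (3 * t) * sin t * sin u + sin (3 * t) * cos t * cos u - sin (3 * u) = - sin (u - t) * crossing t u"
    \<comment> \<open>The parameter 0 gives the constant coefficient of the restricted form.\<close>
    using line_pt_eval[of t 0 u] by (simp add: line_pt_def algebra_simps)
  from arg_cong[OF this, of complex_of_real] show ?thesis
    by (simp add: restr_def aeval_ell ring_morphism_poly_const sin_diff algebra_simps one_pCons)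
qed

lemma line_pt_in_line_of_iff: "line_pt t s \<in> line_of u \<longleftrightarrow> sin (u - t) = 0 \<or> s = crossing t u"
  using line_pt_eval[of t s u] by (auto simp: line_of_def)

lemma line_of_eq_range: "line_of t = range (line_pt t)"
proof (intro equalityI subsetI)
  fix X assume X: "X \<in> line_of t"
  \<comment> \<open>The coordinate of \<open>X\<close> along the unit direction
    \<open>(cos t, - sin t)\<close> of the line.\<close>
  define s where "s = fst X * cos t - snd X * sin t"
  have "X = line_pt t s"
  proof (rule prod_eqI)
    have "fst (line_pt t s) = fst X * ((sin t)\<^sup>2 + (cos t)\<^sup>2)"
      using X by (simp add: line_of_def line_pt_def s_def algebra_simps power2_eq_square
          del: sin_cos_squared_add sin_cos_squared_add2 sin_cos_squared_add3 flip: X[unfolded line_of_def, simplified])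
    then show "fst X = fst (line_pt t s)" by simp
    have "snd (line_pt t s) = snd X * ((sin t)\<^sup>2 + (cos t)\<^sup>2)"
      using X by (simp add: line_of_def line_pt_def s_def algebra_simps power2_eq_square
          del: sin_cos_squared_add sin_cos_squared_add2 sin_cos_squared_add3 flip: X[unfolded line_of_def, simplified])
    then show "snd X = snd (line_pt t s)" by simp
  qed
  then show "X \<in> range (line_pt t)" by blast
qed (auto simp: line_pt_in_line_of_iff)

section \<open>Restriction of forms to a line\<close>

lemma affine_pt_nth [simp]:
  "affine_pt X $ 1 = of_real (fst X)" "affine_pt X $ 2 = of_real (snd X)" "affine_pt X $ 3 = 1"
  by (simp_all add: affine_pt_def)

lemma peval_ell:
  "peval (ell t) (affine_pt X) = of_real (fst X * sin t + snd X * cos t - sin (3 * t))"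
  by (simp add: peval_eq_aeval aeval_ell ring_morphism_ident mult.commute)

lemma poly_restr: "poly (restr t f) (of_real s) = peval f (affine_pt (line_pt t s))"
proof -
  have "(\<lambda>i. poly (tri [:complex_of_real (sin (3 * t) * sin t), of_real (cos t):]
          [:of_real (sin (3 * t) * cos t), - of_real (sin t):] 1 i) (of_real s)) = ($) (affine_pt (line_pt t s))"
    by (rule fun_3_eqI) (simp_all add: line_pt_def)
  then show ?thesis by (simp add: restr_def poly_aeval peval_eq_aeval)
qed

lemma degree_restr_le: "homogeneous d f \<Longrightarrow> degree (restr t f) \<le> d"
  unfolding restr_def by (rule degree_aeval_le) (auto simp: tri_def)

text \<open>Around the parameter \<open>s\<close> the parametrization is the point plus
  \<open>X - s\<close> times the direction vector, whose third coordinate is 0.\<close>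

lemma order_ge_imp_dvd_restr:
  assumes "order_ge m f (affine_pt (line_pt t s))"
  shows "[:- of_real s, 1:] ^ m dvd restr t f"
  unfolding restr_def
proof (rule order_ge_imp_dvd[OF assms])
  show "tri [:of_real (sin (3 * t) * sin t), of_real (cos t):]
          [:of_real (sin (3 * t) * cos t), - of_real (sin t):] 1 i =
    [:affine_pt (line_pt t s) $ i:] + [:- of_real s, 1:] * tri [:of_real (cos t):] [:- of_real (sin t):] 0 i" for i
    by (rule fun_cong[of _ _ i], rule fun_3_eqI) (simp_all add: line_pt_def one_pCons)
qed

text \<open>A linear projection onto the plane \<open>ell t = 0\<close> changes \<open>f\<close>
  only by a multiple of \<open>ell t\<close>, and the projected form vanishes because by homogeneity
  its values come from the restriction.\<close>

lemma restr_eq_0_imp_dvd: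
  assumes hom: "homogeneous d f" and 0: "restr t f = 0"
  shows "ell t dvd f"
proof -
  define S C D where "S = pconst (of_real (sin t))" and "C = pconst (of_real (cos t))"
    and "D = pconst (of_real (sin (3 * t)))"
  define m where "m = C * pvar 1 - S * pvar 2"
  \<comment> \<open>This map fixes the plane \<open>ell t = 0\<close> pointwise: the differences
    \<open>pvar i - \<sigma> i\<close> are \<open>S\<close>, \<open>C\<close> and 0 times
    \<open>ell t\<close>.\<close>
  define \<sigma> where "\<sigma> = tri (S * D * pvar 3 + C * m) (C * D * pvar 3 - S * m) (pvar 3)"
  have SC: "S * S + C * C = 1"
    by (simp add: S_def C_def flip: pconst.mult pconst.add of_real_mult of_real_add)
       (simp flip: power2_eq_square)
  have ell: "ell t = S * pvar 1 + C * pvar 2 - D * pvar 3"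
    by (simp add: ell_def S_def C_def D_def)
  have ids: "(S * S + C * C) * x - (S * D * z + C * (C * x - S * y)) = (S * x + C * y - D * z) * S"
    "(S * S + C * C) * y - (C * D * z - S * (C * x - S * y)) = (S * x + C * y - D * z) * C"
    for S C D x y z :: "'a::comm_ring_1"
    by (simp_all add: algebra_simps)
  have "ell t dvd pvar i - \<sigma> i" for i
  proof -
    have "pvar 1 - \<sigma> 1 = (S * S + C * C) * pvar 1 - \<sigma> 1" by (simp add: SC)
    also have "\<dots> = ell t * S" unfolding \<sigma>_def tri_simps ell m_def by (rule ids)
    finally have 1: "ell t dvd pvar 1 - \<sigma> 1" by simp
    have "pvar 2 - \<sigma> 2 = (S * S + C * C) * pvar 2 - \<sigma> 2" by (simp add: SC)
    also have "\<dots> = ell t * C" unfolding \<sigma>_def tri_simps ell m_def by (rule ids)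
    finally have 2: "ell t dvd pvar 2 - \<sigma> 2" by simp
    have "ell t dvd pvar 3 - \<sigma> 3" by (simp add: \<sigma>_def)
    with 1 2 have "\<forall>i. ell t dvd pvar i - \<sigma> i"
      unfolding forall_3 by blast
    then show ?thesis by blast
  qed
  then have "ell t dvd f - psubst \<sigma> f" by (rule dvd_diff_psubst)
  \<comment> \<open>The chart covers only points with nonzero third coordinate; the factor
    \<open>pvar 3\<close> settles the remaining points and is cancelled at the end.\<close>
  moreover have "pvar 3 * psubst \<sigma> f = 0"
  proof (rule poly3_eq_0I)
    fix v :: "3 \<Rightarrow> complex"
    let ?e = "aeval (\<lambda>c. c) v"
    interpret e: ring_morphism ?e by (intro ring_morphism_aeval ring_morphism_ident)
    have e [simp]: "?e (pconst c) = c" "?e (pvar i) = v i" for c i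
      by (simp_all add: ring_morphism_ident)
    show "?e (pvar 3 * psubst \<sigma> f) = 0"
    proof (cases "v 3 = 0")
      case False
      \<comment> \<open>The line parameter of the projected point after scaling its third coordinate
        to 1.\<close>
      define x where "x = ?e m / v 3"
      let ?w = "tri [:complex_of_real (sin (3 * t) * sin t), of_real (cos t):]
          [:of_real (sin (3 * t) * cos t), - of_real (sin t):] 1"
      have "(\<lambda>i. ?e (\<sigma> i)) = (\<lambda>i. v 3 * poly (?w i) x)"
      proof (rule fun_3_eqI)
        have m: "?e m = v 3 * x" using False by (simp add: x_def)
        have C: "?e C = of_real (cos t)" and S: "?e S = of_real (sin t)" and D: "?e D = of_real (sin (3 * t))"
          by (simp_all add: C_def S_def D_def)
        show "?e (\<sigma> 1) = v 3 * poly (?w 1) x"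
          unfolding \<sigma>_def tri_simps e.add e.mult m C S D e by (simp add: algebra_simps)
        show "?e (\<sigma> 2) = v 3 * poly (?w 2) x"
          unfolding \<sigma>_def tri_simps e.diff e.mult m C S D e by (simp add: algebra_simps)
        show "?e (\<sigma> 3) = v 3 * poly (?w 3) x"
          unfolding \<sigma>_def tri_simps e by simp
      qed
      then have "?e (psubst \<sigma> f) = v 3 ^ d * poly (restr t f) x"
        by (simp add: aeval_psubst ring_morphism_ident restr_def poly_aeval aeval_homogeneous_scale[OF hom])
      then show ?thesis by (simp add: 0)
    qed simp
  qed
  moreover have "pvar 3 \<noteq> 0"
    by (rule pvar_neq_0)
  ultimately show ?thesis by simp
qed

section \<open>Identification of the configuration lines\<close>

lemma boroczky_line_eq: "boroczky_line n j = line_of (pi * real j / real n)"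
proof -
  define t where "t = pi * real j / real n"
  define P Q where "P = circle_pt (2 * t)" and "Q = circle_pt (pi - 4 * t)"
  have eq: "boroczky_line n j = (if P \<noteq> Q then affine hull {P, Q} else {X. (X - P) \<bullet> P = 0})"
    by (simp add: boroczky_line_def Let_def P_def Q_def t_def algebra_simps)
  show ?thesis
  proof (cases "P = Q")
    case True
    then have c: "cos (2 * t) = - cos (4 * t)" and s: "sin (2 * t) = sin (4 * t)"
      by (simp_all add: P_def Q_def circle_pt_def cos_diff sin_diff)
    \<comment> \<open>Coincidence of \<open>P\<close> and \<open>Q\<close> forces
      \<open>cos (3 * t) = 0\<close>; the equation of \<open>line_of t\<close> is then
      \<open>sin (3 * t)\<close> times the tangent equation at \<open>P\<close>.\<close>
    have "cos (6 * t) = cos (4 * t + 2 * t)" by simp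
    also have "\<dots> = - ((cos (4 * t))\<^sup>2 + (sin (4 * t))\<^sup>2)"
      unfolding cos_add c s by (simp add: power2_eq_square del: sin_cos_squared_add3)
    finally have "cos (2 * (3 * t)) = -1" by simp
    then have c3: "cos (3 * t) = 0" unfolding cos_double_cos by simp
    then have s3: "sin (3 * t) \<noteq> 0" using sin_cos_squared_add[of "3 * t"] by auto
    have "sin t = sin (3 * t - 2 * t)" "cos t = cos (3 * t - 2 * t)" by simp_all
    then have st: "sin t = sin (3 * t) * cos (2 * t)" "cos t = sin (3 * t) * sin (2 * t)"
      unfolding sin_diff cos_diff c3 by simp_all
    have "(X - P) \<bullet> P = 0 \<longleftrightarrow> X \<in> line_of t" for X
    proof -
      have "(X - P) \<bullet> P = fst X * cos (2 * t) + snd X * sin (2 * t) - ((sin (2 * t))\<^sup>2 + (cos (2 * t))\<^sup>2)"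
        by (simp only: inner_prod_def)
           (simp add: P_def circle_pt_def power2_eq_square algebra_simps del: sin_cos_squared_add sin_cos_squared_add2 sin_cos_squared_add3)
      then have "(X - P) \<bullet> P = 0 \<longleftrightarrow> fst X * cos (2 * t) + snd X * sin (2 * t) = 1" by simp
      also have "\<dots> \<longleftrightarrow> sin (3 * t) * (fst X * cos (2 * t) + snd X * sin (2 * t)) = sin (3 * t)"
        using s3 by simp
      also have "\<dots> \<longleftrightarrow> X \<in> line_of t"
        unfolding line_of_def st mem_Collect_eq by (simp add: algebra_simps)
      finally show ?thesis .
    qed
    with eq True show ?thesis by (auto simp: t_def)
  next
    case False
    \<comment> \<open>The two memberships are the expansions of \<open>3 * t\<close> as
      \<open>2 * t + t\<close> and as \<open>4 * t - t\<close>.\<close>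
    have "P \<in> line_of t"
      using sin_add[of "2 * t" t] by (simp add: line_of_def P_def circle_pt_def algebra_simps)
    moreover have "Q \<in> line_of t"
      using sin_diff[of "4 * t" t]
      by (simp add: line_of_def Q_def circle_pt_def cos_diff sin_diff algebra_simps)
    ultimately obtain p q where p: "P = line_pt t p" and q: "Q = line_pt t q"
      by (auto simp: line_of_eq_range)
    with False have pq: "q - p \<noteq> 0" by auto
    \<comment> \<open>Affine combinations act affinely on parameters, and since \<open>q - p\<close>
      is nonzero they reach every parameter.\<close>
    have comb: "(1 - v) *\<^sub>R P + v *\<^sub>R Q = line_pt t (p + v * (q - p))" for v
      by (simp add: p q line_pt_def algebra_simps)
    have "affine hull {P, Q} = range (\<lambda>v. (1 - v) *\<^sub>R P + v *\<^sub>R Q)"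
    proof -
      have "u + v = 1 \<longleftrightarrow> u = 1 - v" for u v :: real by auto
      then show ?thesis unfolding affine_hull_2 by auto
    qed
    also have "\<dots> = line_of t"
      unfolding comb line_of_eq_range
    proof (intro equalityI subsetI)
      fix X assume "X \<in> range (line_pt t)"
      then obtain s where X: "X = line_pt t s" by blast
      have "s = p + (s - p) / (q - p) * (q - p)" using pq by simp
      then show "X \<in> range (\<lambda>v. line_pt t (p + v * (q - p)))" unfolding X by (metis rangeI)
    qed auto
    finally show ?thesis using eq False by (simp add: t_def)
  qed
qed

section \<open>Incidences on one line\<close>

lemma sin_pi_frac_eq_0_iff:
  assumes "n > 0"
  shows "sin (pi * of_int m / real n) = 0 \<longleftrightarrow> int n dvd m"
proof -
  have "sin (pi * of_int m / real n) = 0 \<longleftrightarrow> (\<exists>i::int. pi * of_int m / real n = of_int i * pi)"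
    by (simp add: sin_zero_iff_int2)
  also have "\<dots> \<longleftrightarrow> (\<exists>i::int. real_of_int m = real_of_int (int n * i))"
    using assms by (intro ex_cong1) (auto simp: field_simps)
  also have "\<dots> \<longleftrightarrow> int n dvd m"
    unfolding of_int_eq_iff dvd_def ..
  finally show ?thesis .
qed

lemma sin_diff_eq_0_iff:
  assumes "i < n" "j < n"
  shows "sin (pi * real i / real n - pi * real j / real n) = 0 \<longleftrightarrow> i = j"
proof -
  have "pi * real i / real n - pi * real j / real n = pi * of_int (int i - int j) / real n"
    by (simp add: diff_divide_distrib right_diff_distrib)
  then have "sin (pi * real i / real n - pi * real j / real n) = 0 \<longleftrightarrow> int n dvd int i - int j"
    using assms by (simp only: sin_pi_frac_eq_0_iff[of n])
  also have "\<dots> \<longleftrightarrow> i = j"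
    using assms by (auto dest: zdvd_imp_le simp: mod_eq_dvd_iff[symmetric] mod_pos_pos_trivial simp flip: of_nat_mod)
  finally show ?thesis .
qed

text \<open>The difference of the crossings is 4 times the product of \<open>sin (t + u + v)\<close>
  and \<open>sin (v - u)\<close>. The first factor vanishes iff \<open>n\<close> divides
  \<open>i + j + k\<close>, the second iff \<open>j = k\<close>.\<close>

lemma crossing_eq_iff:
  assumes "i < n" "j < n" "k < n"
  shows "crossing (pi * real i / real n) (pi * real j / real n) = crossing (pi * real i / real n) (pi * real k / real n)
    \<longleftrightarrow> j = k \<or> n dvd i + j + k"
proof -
  define t u v where "t = pi * real i / real n" and "u = pi * real j / real n" and "v = pi * real k / real n"
  have "crossing t u - crossing t v = 2 * (cos (t + 2 * u) - cos (t + 2 * v))" by (simp add: crossing_def)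
  also have "\<dots> = 4 * (sin ((t + 2 * u + (t + 2 * v)) / 2) * sin ((t + 2 * v - (t + 2 * u)) / 2))"
    unfolding cos_diff_cos by simp
  also have "(t + 2 * u + (t + 2 * v)) / 2 = pi * of_int (int (i + j + k)) / real n"
    by (simp add: t_def u_def v_def add_divide_distrib distrib_left)
  also have "(t + 2 * v - (t + 2 * u)) / 2 = v - u" by (simp add: field_simps)
  finally have "crossing t u = crossing t v \<longleftrightarrow>
      sin (pi * of_int (int (i + j + k)) / real n) = 0 \<or> sin (v - u) = 0"
    by auto
  then show ?thesis
    using assms sin_pi_frac_eq_0_iff[of n "int (i + j + k)"] sin_diff_eq_0_iff[of k n j]
    by (auto simp: t_def u_def v_def simp del: of_nat_add)
qed

text \<open>Summing over lines instead of points counts every root at most twice, since each value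
  of \<open>r\<close> is taken at most twice.\<close>

lemma sum_order_le_2_degree:
  fixes q :: "complex poly"
  assumes "q \<noteq> 0" and "finite A" and fib: "\<And>y. card {j\<in>A. r j = y} \<le> 2"
  shows "(\<Sum>j\<in>A. Polynomial.order (r j) q) \<le> 2 * degree q"
proof -
  have "(\<Sum>j\<in>A. Polynomial.order (r j) q) = (\<Sum>y\<in>r ` A. \<Sum>j\<in>{j\<in>A. r j = y}. Polynomial.order (r j) q)"
    using \<open>finite A\<close> by (rule sum.image_gen)
  also have "\<dots> = (\<Sum>y\<in>r ` A. card {j\<in>A. r j = y} * Polynomial.order y q)"
    by (intro sum.cong) auto
  also have "\<dots> \<le> (\<Sum>y\<in>r ` A. 2 * Polynomial.order y q)"
    by (intro sum_mono mult_right_mono fib) simp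
  also have "\<dots> = 2 * (\<Sum>y\<in>r ` A. Polynomial.order y q)" by (simp add: sum_distrib_left)
  also have "(\<Sum>y\<in>r ` A. Polynomial.order y q) = (\<Sum>y\<in>{y\<in>r ` A. poly q y = 0}. Polynomial.order y q)"
    using assms by (intro sum.mono_neutral_right) (auto simp: order_root)
  also have "\<dots> \<le> (\<Sum>y | poly q y = 0. Polynomial.order y q)"
    using assms(1) by (intro sum_mono2) (auto simp: poly_roots_finite)
  also have "\<dots> \<le> degree q" by (rule sum_order_le_degree[OF assms(1)])
  finally show ?thesis by simp
qed

section \<open>Congruences between line indices and counts of admissible indices\<close>

lemma dvd_lt_3:
  fixes n x :: nat
  assumes "n dvd x" and "x < 3 * n"
  shows "x = 0 \<or> x = n \<or> x = 2 * n"
proof -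
  from assms obtain k where k: "x = n * k" by (auto elim: dvdE)
  with assms have "k < 3" by simp
  with k show ?thesis by (auto simp: less_Suc_eq numeral_3_eq_3)
qed

lemma mirror_unique:
  fixes j j' :: nat
  assumes "n dvd a + j" "n dvd a + j'" "j < n" "j' < n"
  shows "j = j'"
proof -
  have "n dvd j - j'" "n dvd j' - j"
    using dvd_diff_nat[OF assms(1,2)] dvd_diff_nat[OF assms(2,1)] by simp_all
  then show ?thesis using assms(3,4) by (auto dest!: dvd_imp_le)
qed

lemma card_le_2I: "A \<subseteq> {a, b} \<Longrightarrow> card A \<le> 2"
  using card_mono[of "{a, b}" A] by (auto simp: card_insert_if split: if_splits)

text \<open>Besides \<open>j\<close> there is at most one index completing \<open>i + j\<close> to a
  multiple of \<open>n\<close>.\<close>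

lemma card_mirror_le:
  fixes i j :: nat
  shows "card {k. k < n \<and> (k = j \<or> n dvd i + j + k)} \<le> 2"
proof (cases "\<exists>k0 < n. n dvd i + j + k0")
  case True
  then obtain k0 where "k0 < n" "n dvd i + j + k0" by blast
  then have "{k. k < n \<and> (k = j \<or> n dvd i + j + k)} \<subseteq> {j, k0}"
    by (auto intro: mirror_unique)
  then show ?thesis by (rule card_le_2I)
next
  case False
  then have "{k. k < n \<and> (k = j \<or> n dvd i + j + k)} \<subseteq> {j, j}" by auto
  then show ?thesis by (rule card_le_2I)
qed

text \<open>The indices \<open>j\<close> for which \<open>i\<close>, \<open>j\<close> and the index
  \<open>k\<close> with \<open>n dvd i + j + k\<close> are pairwise distinct, so that lines
  \<open>i\<close> and \<open>j\<close> meet in a triple point: the two divisibilities exclude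
  \<open>k = i\<close> and \<open>k = j\<close>.\<close>

definition admissible :: "nat \<Rightarrow> nat \<Rightarrow> nat set" where
  "admissible n i = {j. j < n \<and> j \<noteq> i \<and> \<not> n dvd 2 * i + j \<and> \<not> n dvd i + 2 * j}"

lemma finite_admissible [simp]: "finite (admissible n i)"
  by (simp add: admissible_def)

lemma card_inadmissible_le:
  fixes i n :: nat
  assumes "i < n"
  shows "card {j. j < n \<and> (j = i \<or> n dvd 2 * i + j)} \<le> 2"
    and "card {j. j < n \<and> n dvd i + 2 * j} \<le> 2"
proof -
  show "card {j. j < n \<and> (j = i \<or> n dvd 2 * i + j)} \<le> 2"
    using card_mirror_le[of n i i] by (simp add: mult_2)
  \<comment> \<open>As \<open>i + 2 * j\<close> lies below \<open>3 * n\<close>, it is 0,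
    \<open>n\<close> or \<open>2 * n\<close>. The case \<open>2 * n\<close> is impossible for
    \<open>i = 0\<close>, the case 0 for \<open>i > 0\<close>, which leaves two candidates.\<close>
  have *: "j \<in> (if i = 0 then {0, n div 2} else {(n - i) div 2, (2 * n - i) div 2})"
    if "j < n" "n dvd i + 2 * j" for j
    using dvd_lt_3[OF that(2)] that assms by auto
  show "card {j. j < n \<and> n dvd i + 2 * j} \<le> 2"
  proof (cases "i = 0")
    case True
    with * show ?thesis by (intro card_le_2I[of _ 0 "n div 2"] subsetI) simp
  next
    case False
    with * show ?thesis
      by (intro card_le_2I[of _ "(n - i) div 2" "(2 * n - i) div 2"] subsetI) simp
  qed
qed

text \<open>At most 2 + 2 indices are excluded, each of weight at most 3; without solutions of
  \<open>n dvd i + 2 * j\<close> only the first 2 remain.\<close>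

lemma sum_admissible_ge:
  fixes w :: "nat \<Rightarrow> nat"
  assumes "i < n" and w: "\<And>j. w j \<le> 3"
  shows "(\<Sum>j<n. w j) \<le> (\<Sum>j\<in>admissible n i. w j) + 12"
    and "\<not> (\<exists>j<n. n dvd i + 2 * j) \<Longrightarrow> (\<Sum>j<n. w j) \<le> (\<Sum>j\<in>admissible n i. w j) + 6"
proof -
  define E F where "E = {j. j < n \<and> (j = i \<or> n dvd 2 * i + j)}" and "F = {j. j < n \<and> n dvd i + 2 * j}"
  have fin: "finite E" "finite F" by (simp_all add: E_def F_def)
  have le: "(\<Sum>j\<in>X. w j) \<le> 3 * card X" for X
    using sum_bounded_above[of X w 3] w by simp
  have "{..<n} = admissible n i \<union> (E \<union> F)"
    by (auto simp: admissible_def E_def F_def)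
  moreover have "admissible n i \<inter> (E \<union> F) = {}"
    by (auto simp: admissible_def E_def F_def)
  ultimately have "(\<Sum>j<n. w j) = (\<Sum>j\<in>admissible n i. w j) + (\<Sum>j\<in>E \<union> F. w j)"
    using fin by (simp add: sum.union_disjoint)
  moreover have "(\<Sum>j\<in>E \<union> F. w j) \<le> 3 * card (E \<union> F)" by (rule le)
  moreover have "card (E \<union> F) \<le> card E + card F" by (rule card_Un_le)
  moreover have "card E \<le> 2"
    using card_inadmissible_le(1)[OF assms(1)] by (simp add: E_def)
  ultimately have *: "(\<Sum>j<n. w j) \<le> (\<Sum>j\<in>admissible n i. w j) + 6 + 3 * card F"
    by linarith
  moreover have "card F \<le> 2"
    using card_inadmissible_le(2)[OF assms(1)] by (simp add: F_def)
  ultimately show "(\<Sum>j<n. w j) \<le> (\<Sum>j\<in>admissible n i. w j) + 12" by linarith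
  show "(\<Sum>j<n. w j) \<le> (\<Sum>j\<in>admissible n i. w j) + 6" if "\<not> (\<exists>j<n. n dvd i + 2 * j)"
  proof -
    have "F = {}" using that by (auto simp: F_def)
    with * show ?thesis by simp
  qed
qed

text \<open>For even \<open>n\<close>, the order that the cofactor of the odd lines still needs on
  an even line \<open>i\<close> at its point with line \<open>j\<close>. If \<open>j\<close> is odd,
  so is the third line, and up to two of the three orders are used up; if \<open>j\<close> is even,
  no odd line passes through the point.\<close>

definition weight :: "nat \<Rightarrow> nat" where
  "weight j = (if odd j then 1 else 3)"

lemma sum_weight: "(\<Sum>j<2 * m. weight j) = 4 * m"
  by (induction m) (simp_all add: weight_def)

lemma card_odd: "card {j. j < 2 * m \<and> odd j} = m"
proof -
  have "card {j. j < 2 * m \<and> odd j} = (\<Sum>j\<in>{j \<in> {..<2 * m}. odd j}. 1)" by simp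
  also have "\<dots> = (\<Sum>j<2 * m. if odd j then 1 else 0)"
    by (rule sum.inter_filter) simp
  also have "\<dots> = m" by (induction m) simp_all
  finally show ?thesis .
qed

text \<open>All weights add up to \<open>2 * n\<close>, so at least \<open>2 * n - 12\<close>
  remains, which exceeds \<open>n\<close> for \<open>n > 12\<close>. At \<open>n = 12\<close> this
  estimate only gives equality, and the six even indices are checked individually.\<close>

lemma sum_weight_admissible:
  assumes "12 \<le> n" and "6 dvd n" and "i < n" and "even i"
  shows "n < (\<Sum>j\<in>admissible n i. weight j)"
proof (cases "n = 12")
  case True
  have eq: "admissible 12 i = set (filter (\<lambda>j. j \<noteq> i \<and> (2 * i + j) mod 12 \<noteq> 0 \<and> (i + 2 * j) mod 12 \<noteq> 0) [0..<12])"
    by (auto simp: admissible_def dvd_eq_mod_eq_0)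
  have "i = 0 \<or> i = 2 \<or> i = 4 \<or> i = 6 \<or> i = 8 \<or> i = 10"
    using assms True by (auto elim!: evenE)
  then show ?thesis
    unfolding True eq by (elim disjE) (simp_all add: upt_rec weight_def)
next
  case False
  obtain m where m: "n = 2 * m" using \<open>6 dvd n\<close> by (auto elim!: dvdE)
  have "12 < n" using False assms by simp
  moreover have "4 * m \<le> (\<Sum>j\<in>admissible n i. weight j) + 12"
    using sum_admissible_ge(1)[OF assms(3), of weight] unfolding m sum_weight by (simp add: weight_def)
  ultimately show ?thesis using m by linarith
qed

section \<open>Divisibility by the lines\<close>

abbreviation ang :: "nat \<Rightarrow> nat \<Rightarrow> real" where
  "ang n j \<equiv> pi * real j / real n"

lemma line_pt_in_line_of_ang_iff:
  assumes "i < n" "j < n" "i \<noteq> j"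
  shows "line_pt (ang n i) s \<in> line_of (ang n j) \<longleftrightarrow> s = crossing (ang n i) (ang n j)"
  using assms sin_diff_eq_0_iff[of j n i] by (simp add: line_pt_in_line_of_iff)

text \<open>Lines with different indices meet in a single parameter, whereas equal lines would share
  all parameters.\<close>

lemma inj_on_line_of_ang: "inj_on (\<lambda>j. line_of (ang n j)) {..<n}"
proof (rule inj_onI, rule ccontr)
  fix i j assume "i \<in> {..<n}" "j \<in> {..<n}" and eq: "line_of (ang n i) = line_of (ang n j)" and "i \<noteq> j"
  then have "line_pt (ang n i) s \<in> line_of (ang n i) \<longleftrightarrow> s = crossing (ang n i) (ang n j)" for s
    unfolding eq using line_pt_in_line_of_ang_iff by simp
  then have "s = crossing (ang n i) (ang n j)" for s
    by (simp add: line_of_eq_range)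
  from this[of 0] this[of 1] show False by simp
qed

lemma boroczky_lines_eq: "boroczky_lines n = (\<lambda>j. line_of (ang n j)) ` {..<n}"
  by (simp add: boroczky_lines_def boroczky_line_eq atLeast0LessThan)

lemma card_lines_through:
  "card {L \<in> boroczky_lines n. X \<in> L} = card {j. j < n \<and> X \<in> line_of (ang n j)}"
proof -
  have "{L \<in> boroczky_lines n. X \<in> L} = (\<lambda>j. line_of (ang n j)) ` {j. j < n \<and> X \<in> line_of (ang n j)}"
    by (auto simp: boroczky_lines_eq)
  then show ?thesis
    by (simp add: card_image inj_on_subset[OF inj_on_line_of_ang] subset_iff)
qed

text \<open>By \<open>crossing_eq_iff\<close> the lines through the point are \<open>i\<close>,
  \<open>j\<close> and the index completing their sum; admissibility makes these distinct.\<close>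

lemma card_lines_through_admissible:
  assumes i: "i < n" and j: "j \<in> admissible n i"
  shows "card {L \<in> boroczky_lines n. line_pt (ang n i) (crossing (ang n i) (ang n j)) \<in> L} = 3"
proof -
  let ?X = "line_pt (ang n i) (crossing (ang n i) (ang n j))"
  have j': "j < n" "j \<noteq> i" "\<not> n dvd 2 * i + j" "\<not> n dvd i + 2 * j"
    using j by (auto simp: admissible_def)
  \<comment> \<open>The residue of \<open>- (i + j)\<close>; starting from \<open>2 * n\<close>
    keeps the natural subtraction exact.\<close>
  define k where "k = (2 * n - (i + j)) mod n"
  have k: "k < n" "n dvd i + j + k"
  proof -
    show "k < n" using i by (simp add: k_def)
    have "(i + j + k) mod n = (i + j + (2 * n - (i + j))) mod n"
      unfolding k_def by (simp add: mod_add_right_eq)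
    also have "i + j + (2 * n - (i + j)) = 2 * n" using i j' by simp
    finally show "n dvd i + j + k" by (simp add: dvd_eq_mod_eq_0)
  qed
  have "k \<noteq> i" "k \<noteq> j"
    using k(2) j'(3,4) by (auto simp: algebra_simps mult_2 mult_2_right)
  have "{u. u < n \<and> ?X \<in> line_of (ang n u)} = {i, j, k}"
  proof (intro equalityI subsetI)
    fix u assume "u \<in> {u. u < n \<and> ?X \<in> line_of (ang n u)}"
    then have u: "u < n" "?X \<in> line_of (ang n u)" by auto
    have "j = u \<or> n dvd i + j + u" if "u \<noteq> i"
      using line_pt_in_line_of_ang_iff[OF i u(1)] that u(2) crossing_eq_iff[OF i j'(1) u(1)] by auto
    then show "u \<in> {i, j, k}" using mirror_unique[OF k(2) _ k(1) u(1)] by auto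
  next
    fix u assume "u \<in> {i, j, k}"
    then show "u \<in> {u. u < n \<and> ?X \<in> line_of (ang n u)}"
      using i j' k line_pt_in_line_of_ang_iff[OF i, of u] crossing_eq_iff[OF i j'(1) k(1)]
      by (cases "u = i") (auto simp: line_of_eq_range)
  qed
  then show ?thesis
    unfolding card_lines_through using \<open>k \<noteq> i\<close> \<open>k \<noteq> j\<close> j'(2) by simp
qed

definition vanishes :: "nat \<Rightarrow> nat \<Rightarrow> poly3 \<Rightarrow> bool" where
  "vanishes n m f \<longleftrightarrow> (\<forall>P\<in>triple_points n. \<forall>p\<in>P. order_ge m f p)"

lemma vanishes_imp_dvd_restr:
  assumes "vanishes n m f" and "i < n" and "j \<in> admissible n i"
  shows "[:- of_real (crossing (ang n i) (ang n j)), 1:] ^ m dvd restr (ang n i) f"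
proof (rule order_ge_imp_dvd_restr)
  let ?X = "line_pt (ang n i) (crossing (ang n i) (ang n j))"
  have "proj_point (affine_pt ?X) \<in> triple_points n"
    unfolding triple_points_def using card_lines_through_admissible[OF assms(2,3)] by blast
  moreover have "affine_pt ?X \<in> proj_point (affine_pt ?X)"
    unfolding proj_point_def by (metis (mono_tags, lifting) mem_Collect_eq vector_smult_lid zero_neq_one)
  ultimately show "order_ge m f (affine_pt ?X)"
    using assms(1) by (auto simp: vanishes_def)
qed

lemma restr_ell_ang_neq_0:
  "i < n \<Longrightarrow> j < n \<Longrightarrow> i \<noteq> j \<Longrightarrow> restr (ang n i) (ell (ang n j)) \<noteq> 0"
  using sin_diff_eq_0_iff[of j n i] by (simp add: restr_ell)

text \<open>Lines are split off one at a time: the forms of the other lines restrict to nonzero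
  polynomials, so the restriction of the cofactor must vanish.\<close>

lemma prod_ell_dvd:
  assumes "finite S" and "S \<subseteq> {..<n}" and "homogeneous d f" and "f \<noteq> 0"
    and "\<And>i. i \<in> S \<Longrightarrow> restr (ang n i) f = 0"
  shows "card S \<le> d \<and> (\<exists>g. homogeneous (d - card S) g \<and> f = (\<Prod>i\<in>S. ell (ang n i)) * g)"
  using assms(1,2,5)
proof (induction S rule: finite_induct)
  case empty
  then show ?case using assms(3) by auto
next
  case (insert i S)
  then obtain g where le: "card S \<le> d" and g: "homogeneous (d - card S) g"
    and f: "f = (\<Prod>i\<in>S. ell (ang n i)) * g"
    by auto
  have "restr (ang n i) f = 0" using insert.prems by simp
  moreover have "(\<Prod>j\<in>S. restr (ang n i) (ell (ang n j))) \<noteq> 0"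
    using insert restr_ell_ang_neq_0[of i n] by (auto simp: prod_zero_iff)
  ultimately have "restr (ang n i) g = 0" by (simp add: f)
  with g have dvd: "ell (ang n i) dvd g" by (rule restr_eq_0_imp_dvd)
  \<comment> \<open>A nonzero multiple of a linear form has positive degree, so another line can be
    split off.\<close>
  have "g \<noteq> 0" using f assms(4) by auto
  then have "1 \<le> d - card S"
    using homogeneous_dvd_eq_0[OF g homogeneous_ell dvd] by linarith
  with g obtain h where h: "g = ell (ang n i) * h" "homogeneous (d - card S - 1) h"
    using homogeneous_dvd[OF _ homogeneous_ell dvd] by blast
  have "f = (\<Prod>i\<in>insert i S. ell (ang n i)) * h"
    unfolding prod.insert[OF insert.hyps] f h(1) by (simp only: mult_ac)
  moreover have "homogeneous (d - card (insert i S)) h" "card (insert i S) \<le> d"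
    using h(2) insert.hyps \<open>1 \<le> d - card S\<close> by simp_all
  ultimately show ?case by blast
qed

lemma order_linear: "c \<noteq> 0 \<Longrightarrow> Polynomial.order r (smult c [:- a, 1:]) = (if a = r then 1 else (0::nat))"
  for a r c :: complex
  using order_power_n_n[of r 1] by (auto simp: order_smult simp del: smult_pCons intro!: order_0I)

lemma order_prod_linear:
  fixes a c :: "'b \<Rightarrow> complex"
  assumes "finite S" and "\<And>k. k \<in> S \<Longrightarrow> c k \<noteq> 0"
  shows "Polynomial.order r (\<Prod>k\<in>S. smult (c k) [:- a k, 1:]) = card {k\<in>S. a k = r}"
  using assms
proof (induction S rule: finite_induct)
  case (insert k S)
  have ne: "(\<Prod>k\<in>insert k S. smult (c k) [:- a k, 1:]) \<noteq> 0"
    using insert by (auto simp del: smult_pCons mult_smult_left)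
  have "{k'\<in>insert k S. a k' = r} = (if a k = r then insert k {k'\<in>S. a k' = r} else {k'\<in>S. a k' = r})"
    by auto
  then show ?case
    using ne insert.hyps insert.IH insert.prems unfolding prod.insert[OF insert.hyps]
    by (simp add: order_mult[OF ne[unfolded prod.insert[OF insert.hyps]]] order_linear del: smult_pCons mult_smult_left mult_smult_right)
qed simp

section \<open>Forms of degree at most n vanishing to order 3 at the triple points\<close>

context
  fixes n d :: nat and f :: poly3
  assumes n: "12 \<le> n" "6 dvd n" and hom: "homogeneous d f" and van: "vanishes n 3 f" and le: "d \<le> n"
begin

text \<open>A triple point on line \<open>i\<close> lies on two further lines.\<close>

lemma card_fibre_crossing_le:
  assumes "i < n"
  shows "card {j \<in> admissible n i. complex_of_real (crossing (ang n i) (ang n j)) = y} \<le> 2"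
proof (cases "\<exists>j \<in> admissible n i. complex_of_real (crossing (ang n i) (ang n j)) = y")
  case True
  then obtain j where j: "j \<in> admissible n i" "complex_of_real (crossing (ang n i) (ang n j)) = y" by blast
  have "{k \<in> admissible n i. complex_of_real (crossing (ang n i) (ang n k)) = y} \<subseteq> {k. k < n \<and> (k = j \<or> n dvd i + j + k)}"
  proof
    fix k assume "k \<in> {k \<in> admissible n i. complex_of_real (crossing (ang n i) (ang n k)) = y}"
    with j have lt: "j < n" "k < n" and eq: "crossing (ang n i) (ang n j) = crossing (ang n i) (ang n k)"
      by (auto simp: admissible_def)
    from eq have "j = k \<or> n dvd i + j + k"
      by (rule crossing_eq_iff[OF assms lt, THEN iffD1])
    then show "k \<in> {k. k < n \<and> (k = j \<or> n dvd i + j + k)}"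
      using lt by auto
  qed
  from card_mono[OF _ this] show ?thesis
    using card_mirror_le[of n j i] by simp
next
  case False
  then have none: "{j \<in> admissible n i. complex_of_real (crossing (ang n i) (ang n j)) = y} = {}" by blast
  show ?thesis unfolding none by simp
qed

lemma restr_odd_eq_0:
  assumes i: "i < n" and "odd i"
  shows "restr (ang n i) f = 0"
proof (rule ccontr)
  let ?q = "restr (ang n i) f" and ?r = "\<lambda>j. complex_of_real (crossing (ang n i) (ang n j))"
  assume q: "?q \<noteq> 0"
  have "even n" using n(2) by (meson dvd_trans even_numeral)
  with \<open>odd i\<close> have "\<not> (\<exists>j<n. n dvd i + 2 * j)"
    by (metis dvd_trans dvd_add_left_iff dvd_triv_left)
  \<comment> \<open>At least \<open>n - 2\<close> indices are admissible, so the orders sum to at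
    least \<open>3 * n - 6\<close>, against the bound \<open>2 * n\<close>.\<close>
  then have "(\<Sum>j<n. 3) \<le> (\<Sum>j\<in>admissible n i. 3) + (6::nat)"
    using sum_admissible_ge(2)[OF i, of "\<lambda>_. 3"] by simp
  also have "(\<Sum>j\<in>admissible n i. 3) \<le> (\<Sum>j\<in>admissible n i. Polynomial.order (?r j) ?q)"
    using vanishes_imp_dvd_restr[OF van i] q by (intro sum_mono) (simp add: order_divides)
  also have "\<dots> \<le> 2 * degree ?q"
    using q i by (intro sum_order_le_2_degree card_fibre_crossing_le) auto
  also have "degree ?q \<le> n" using degree_restr_le[OF hom] le by (rule le_trans)
  finally show False using n by simp
qed

text \<open>After division by the \<open>n / 2\<close> odd lines the cofactor has degree at most
  \<open>n / 2\<close>, so its orders summed over lines are at most \<open>n\<close>, while the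
  weights demand more.\<close>

lemma restr_even_eq_0:
  assumes i: "i < n" and "even i" and f: "f \<noteq> 0"
  shows "restr (ang n i) f = 0"
proof (rule ccontr)
  let ?r = "\<lambda>j. complex_of_real (crossing (ang n i) (ang n j))"
  assume ne: "restr (ang n i) f \<noteq> 0"
  define Od where "Od = {k. k < n \<and> odd k}"
  obtain m where m: "n = 2 * m" using n(2) by (auto elim!: dvdE)
  then have card_Od: "card Od = m" by (simp add: Od_def card_odd)
  have Od: "finite Od" "Od \<subseteq> {..<n}" by (auto simp: Od_def)
  with prod_ell_dvd[OF this hom f] restr_odd_eq_0
  obtain g where g: "homogeneous (d - m) g" and fg: "f = (\<Prod>k\<in>Od. ell (ang n k)) * g"
    unfolding card_Od by (auto simp: Od_def)
  define q where "q = restr (ang n i) g"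
  define p where "p = (\<Prod>k\<in>Od. smult (of_real (sin (ang n k - ang n i))) [:- ?r k, 1:])"
  have fpq: "restr (ang n i) f = p * q"
    by (simp add: fg p_def q_def restr_ell)
  with ne have p: "p \<noteq> 0" and q: "q \<noteq> 0" by auto
  have "weight j \<le> Polynomial.order (?r j) q" if j: "j \<in> admissible n i" for j
  proof -
    have jn: "j < n" using j by (simp add: admissible_def)
    have cr: "crossing (ang n i) (ang n k) = crossing (ang n i) (ang n j) \<longleftrightarrow> k = j \<or> n dvd i + j + k"
      if "k < n" for k
      using crossing_eq_iff[OF i jn that] by metis
    have "3 \<le> Polynomial.order (?r j) (p * q)"
      using vanishes_imp_dvd_restr[OF van i j] ne by (simp add: order_divides fpq)
    also have "\<dots> = Polynomial.order (?r j) p + Polynomial.order (?r j) q"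
      using ne by (intro order_mult) (simp add: fpq)
    \<comment> \<open>The order of \<open>p\<close> is the number of odd lines through the
      point.\<close>
    also have "Polynomial.order (?r j) p = card {k\<in>Od. ?r k = ?r j}"
      unfolding p_def
      using i \<open>even i\<close> sin_diff_eq_0_iff[of _ n i] by (intro order_prod_linear Od) (auto simp: Od_def)
    also have "{k\<in>Od. ?r k = ?r j} = {k. k < n \<and> odd k \<and> (k = j \<or> n dvd i + j + k)}"
      by (auto simp: Od_def cr)
    finally have le3: "3 \<le> card {k. k < n \<and> odd k \<and> (k = j \<or> n dvd i + j + k)} + Polynomial.order (?r j) q" .
    show ?thesis
    proof (cases "odd j")
      case True
      have "card {k. k < n \<and> odd k \<and> (k = j \<or> n dvd i + j + k)} \<le> card {k. k < n \<and> (k = j \<or> n dvd i + j + k)}"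
        by (rule card_mono) auto
      with card_mirror_le[of n j i] le3 True show ?thesis by (simp add: weight_def)
    next
      case False
      \<comment> \<open>With \<open>i\<close>, \<open>j\<close> and \<open>n\<close> even, the third
        index is even as well.\<close>
      have "even (i + j + k)" if "n dvd i + j + k" for k
        using m that by (meson dvd_trans dvd_triv_left)
      with False \<open>even i\<close> have none: "{k. k < n \<and> odd k \<and> (k = j \<or> n dvd i + j + k)} = {}"
        by auto
      show ?thesis using le3 False unfolding none by (simp add: weight_def)
    qed
  qed
  then have "(\<Sum>j\<in>admissible n i. weight j) \<le> (\<Sum>j\<in>admissible n i. Polynomial.order (?r j) q)"
    by (rule sum_mono)
  also have "\<dots> \<le> 2 * degree q"
    using q i by (intro sum_order_le_2_degree card_fibre_crossing_le) auto
  also have "degree q \<le> d - m" unfolding q_def by (rule degree_restr_le[OF g])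
  finally show False
    using sum_weight_admissible[OF n i \<open>even i\<close>] le m by simp
qed

lemma vanishes_imp_multiple:
  assumes "f \<noteq> 0"
  shows "d = n" and "\<exists>c. f = pconst c * (\<Prod>j<n. ell (ang n j))"
proof -
  have "restr (ang n i) f = 0" if "i < n" for i
    using restr_odd_eq_0 restr_even_eq_0 that assms by blast
  then have *: "n \<le> d \<and> (\<exists>g. homogeneous (d - n) g \<and> f = (\<Prod>i<n. ell (ang n i)) * g)"
    using prod_ell_dvd[of "{..<n}" n, OF _ _ hom assms] by simp
  with le show "d = n" by simp
  with * obtain g where "homogeneous 0 g" "f = (\<Prod>i<n. ell (ang n i)) * g" by auto
  then show "\<exists>c. f = pconst c * (\<Prod>j<n. ell (ang n j))"
    by (metis homogeneous_0_imp_pconst mult.commute)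
qed

end

section \<open>The product of all lines, and uniqueness of the form of a line\<close>

lemma pshift_ell: "pshift p (ell t) = pconst (peval (ell t) p) + ell t"
proof -
  have "pshift p (ell t) = pconst (of_real (sin t)) * (pconst (p $ 1) + pvar 1)
      + pconst (of_real (cos t)) * (pconst (p $ 2) + pvar 2)
      - pconst (of_real (sin (3 * t))) * (pconst (p $ 3) + pvar 3)"
    by (simp add: pshift_def psubst_eq_aeval aeval_ell ring_morphism_pconst)
  also have "\<dots> = pconst (of_real (sin t) * p $ 1 + of_real (cos t) * p $ 2 - of_real (sin (3 * t)) * p $ 3) + ell t"
    by (simp add: ell_def distrib_left)
  also have "of_real (sin t) * p $ 1 + of_real (cos t) * p $ 2 - of_real (sin (3 * t)) * p $ 3 = peval (ell t) p"
    by (simp add: peval_eq_aeval aeval_ell ring_morphism_ident)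
  finally show ?thesis .
qed

text \<open>Each of the three lines through the point gives a factor whose Taylor expansion has no
  constant term; the other factors only preserve the order.\<close>

lemma vanishes_prod_ell: "vanishes n 3 (\<Prod>j<n. ell (ang n j))"
  unfolding vanishes_def triple_points_def
proof (clarsimp)
  fix a b p assume three: "card {L \<in> boroczky_lines n. (a, b) \<in> L} = 3" and p: "p \<in> proj_point (affine_pt (a, b))"
  let ?X = "(a, b)"
  define U where "U = {j. j < n \<and> ?X \<in> line_of (ang n j)}"
  from p obtain c where c: "p = c *s affine_pt ?X" by (auto simp: proj_point_def)
  have U: "card U = 3" "finite U" "U \<subseteq> {..<n}"
    using three by (auto simp: card_lines_through U_def)
  have "lowdeg 1 (pshift p (ell (ang n j)))" if "j \<in> U" for j
  proof -
    have "peval (ell (ang n j)) p = c * peval (ell (ang n j)) (affine_pt ?X)"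
      by (simp add: c peval_eq_aeval aeval_ell ring_morphism_ident algebra_simps)
    also have "peval (ell (ang n j)) (affine_pt ?X) = 0"
      using that unfolding peval_ell by (simp add: U_def line_of_def)
    finally show ?thesis
      by (simp add: pshift_ell homogeneous_imp_lowdeg homogeneous_ell[simplified])
  qed
  then have "lowdeg 3 (\<Prod>j\<in>U. pshift p (ell (ang n j)))"
    using lowdeg_prod[OF U(2)] U(1) by simp
  moreover have "pshift p (\<Prod>j<n. ell (ang n j)) =
      (\<Prod>j\<in>U. pshift p (ell (ang n j))) * (\<Prod>j\<in>{..<n} - U. pshift p (ell (ang n j)))"
    using U by (simp add: prod.subset_diff[of U "{..<n}"] mult.commute)
  ultimately show "order_ge 3 (\<Prod>j<n. ell (ang n j)) p"
    using lowdeg_mult[of 3 _ 0] by (simp add: order_ge_iff)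
qed

text \<open>On the perpendicular line, at angle \<open>t + pi / 2\<close>, the form restricts to a
  polynomial of degree 1.\<close>

lemma ell_neq_0: "ell t \<noteq> 0"
proof
  assume "ell t = 0"
  then have "restr (t + pi / 2) (ell t) = 0" by simp
  then show False by (simp add: restr_ell)
qed

text \<open>The restriction of \<open>l\<close> has all real numbers as roots, hence is 0. So
  \<open>ell t\<close> divides \<open>l\<close>, and equality of degrees leaves a constant.\<close>

lemma defines_line_unique:
  assumes "defines_line l (line_of t)"
  shows "\<exists>c. c \<noteq> 0 \<and> l = pconst c * ell t"
proof -
  have hom: "homogeneous 1 l" and zeros: "{X. peval l (affine_pt X) = 0} = line_of t"
    using assms by (auto simp: defines_line_def)
  have "poly (restr t l) (of_real s) = 0" for s
    using zeros by (auto simp: poly_restr line_of_eq_range)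
  then have "range complex_of_real \<subseteq> {x. poly (restr t l) x = 0}" by auto
  moreover have "infinite (range complex_of_real)"
    by (simp add: finite_image_iff inj_of_real infinite_UNIV_char_0)
  ultimately have "restr t l = 0"
    using poly_roots_finite finite_subset by blast
  with hom have "ell t dvd l" by (rule restr_eq_0_imp_dvd)
  then obtain g where "l = ell t * g" "homogeneous 0 g"
    using homogeneous_dvd[OF hom homogeneous_ell] by auto
  then obtain c where c: "l = pconst c * ell t"
    by (metis homogeneous_0_imp_pconst mult.commute)
  have "c \<noteq> 0"
  proof
    assume "c = 0"
    then have "line_of t = UNIV"
      using zeros c by (simp add: peval_def)
    \<comment> \<open>A point off the line: the foot of the perpendicular moved by 1 along the
      normal.\<close>
    then have "((sin (3 * t) + 1) * sin t, (sin (3 * t) + 1) * cos t) \<in> line_of t" by blast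
    then have "(sin (3 * t) + 1) * sin t * sin t + (sin (3 * t) + 1) * cos t * cos t = sin (3 * t)"
      by (simp add: line_of_def)
    moreover have "(sin (3 * t) + 1) * sin t * sin t + (sin (3 * t) + 1) * cos t * cos t =
        (sin (3 * t) + 1) * ((sin t)\<^sup>2 + (cos t)\<^sup>2)"
      by (simp only: power2_eq_square algebra_simps)
    ultimately show False by simp
  qed
  with c show ?thesis by blast
qed

section \<open>The symbolic cube and the dihedral action\<close>

text \<open>The generators are homogeneous, so taking a component of a multiple \<open>c * x\<close>
  only replaces \<open>c\<close> by one of its components. Thus statements about arbitrary elements
  reduce to forms.\<close>

lemma symbolic_power_imp_vanishes_hcomp:
  assumes "f \<in> symbolic_power (triple_points n) m"
  shows "vanishes n m (hcomp d f)"
  using assms unfolding symbolic_power_def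
proof (induction f rule: ring_mod.span_induct_alt)
  case base
  show ?case by (simp add: vanishes_def)
next
  case (step c x y)
  then obtain e where e: "homogeneous e x" and x: "vanishes n m x" by (auto simp: vanishes_def)
  have "vanishes n m (hcomp d (c * x))"
    using x by (auto simp: hcomp_mult_homogeneous[OF e] vanishes_def order_ge_mult)
  with step show ?case
    by (auto simp: hcomp_add vanishes_def order_ge_add)
qed

lemma symbolic_power_homogeneous:
  assumes "homogeneous d f"
  shows "f \<in> symbolic_power (triple_points n) m \<longleftrightarrow> vanishes n m f"
proof
  assume "f \<in> symbolic_power (triple_points n) m"
  from symbolic_power_imp_vanishes_hcomp[OF this, of d] show "vanishes n m f"
    using assms by (simp add: hcomp_homogeneous)
next
  assume "vanishes n m f"
  with assms show "f \<in> symbolic_power (triple_points n) m"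
    unfolding symbolic_power_def by (intro ring_mod.span_base) (auto simp: vanishes_def)
qed

lemma hcomp_total_degree_neq_0:
  assumes "f \<noteq> 0"
  shows "hcomp (total_degree f) f \<noteq> 0"
proof -
  have "Poly_Mapping.keys f \<noteq> {}"
    using assms unfolding poly_mapping_eq_iff fun_eq_iff lookup_zero by (metis empty_iff in_keys_iff)
  then have "Max (mdeg ` Poly_Mapping.keys f) \<in> mdeg ` Poly_Mapping.keys f"
    by (intro Max_in) auto
  moreover have "total_degree f = Max (mdeg ` Poly_Mapping.keys f)"
    using \<open>Poly_Mapping.keys f \<noteq> {}\<close> by (simp add: total_degree_def)
  ultimately obtain k where "k \<in> Poly_Mapping.keys f" "mdeg k = total_degree f" by auto
  then have "Poly_Mapping.lookup (hcomp (total_degree f) f) k \<noteq> 0"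
    by (simp only: lookup_hcomp in_keys_iff if_True simp_thms)
  then show ?thesis by (metis lookup_zero)
qed

lemma total_degree_homogeneous:
  assumes "homogeneous d f" and "f \<noteq> 0"
  shows "total_degree f = d"
  using hcomp_total_degree_neq_0[OF assms(2)] hcomp_homogeneous[OF assms(1)] by (metis (full_types))

section \<open>The graded piece of degree n and the initial degree\<close>

definition lines_form :: "nat \<Rightarrow> poly3" where
  "lines_form n = (\<Prod>j<n. ell (ang n j))"

lemma lines_form_neq_0: "lines_form n \<noteq> 0"
  by (simp add: lines_form_def ell_neq_0)

lemma homogeneous_lines_form: "homogeneous n (lines_form n)"
  unfolding lines_form_def using homogeneous_prod[of "{..<n}", OF homogeneous_ell] by simp

lemma homogeneous_pscale: "homogeneous d f \<Longrightarrow> homogeneous d (pscale c f)"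
  by (simp add: pscale_def homogeneous_pconst_mult)

lemma cspan_singleton: "cspan {f} = range (\<lambda>c. pscale c f)"
  by (rule cvec.span_singleton)

lemma graded_piece_eq:
  assumes "12 \<le> n" and "6 dvd n"
  shows "graded_piece n (symbolic_power (triple_points n) 3) = cspan {lines_form n}"
proof (intro equalityI subsetI)
  fix f assume "f \<in> graded_piece n (symbolic_power (triple_points n) 3)"
  then have hom: "homogeneous n f" and van: "vanishes n 3 f"
    by (auto simp: graded_piece_def symbolic_power_homogeneous)
  show "f \<in> cspan {lines_form n}"
  proof (cases "f = 0")
    case False
    with vanishes_imp_multiple(2)[OF assms hom van order_refl] show ?thesis
      by (auto simp: cspan_singleton pscale_def lines_form_def)
  qed (simp add: cvec.span_zero)
next
  fix f assume "f \<in> cspan {lines_form n}"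
  then obtain c where f: "f = pscale c (lines_form n)" by (auto simp: cspan_singleton)
  have hom: "homogeneous n f" unfolding f by (rule homogeneous_pscale[OF homogeneous_lines_form])
  moreover have "vanishes n 3 f"
    using vanishes_prod_ell[of n] by (auto simp: f pscale_def vanishes_def order_ge_mult lines_form_def)
  ultimately show "f \<in> graded_piece n (symbolic_power (triple_points n) 3)"
    by (simp add: graded_piece_def symbolic_power_homogeneous)
qed

text \<open>The top component of a nonzero element is a nonzero form vanishing to order 3, so its
  degree cannot be below \<open>n\<close>.\<close>

lemma alpha_eq:
  assumes "12 \<le> n" and "6 dvd n"
  shows "alpha (symbolic_power (triple_points n) 3) = n"
  unfolding alpha_def
proof (rule Least_equality)
  have "lines_form n \<in> symbolic_power (triple_points n) 3"
    using vanishes_prod_ell[of n] symbolic_power_homogeneous[OF homogeneous_lines_form]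
    by (simp add: lines_form_def)
  then show "\<exists>f\<in>symbolic_power (triple_points n) 3. f \<noteq> 0 \<and> total_degree f = n"
    using lines_form_neq_0 total_degree_homogeneous homogeneous_lines_form by blast
next
  fix d assume "\<exists>f\<in>symbolic_power (triple_points n) 3. f \<noteq> 0 \<and> total_degree f = d"
  then obtain f where f: "f \<in> symbolic_power (triple_points n) 3" "f \<noteq> 0" "total_degree f = d" by blast
  then have "hcomp d f \<noteq> 0" "vanishes n 3 (hcomp d f)"
    using hcomp_total_degree_neq_0 symbolic_power_imp_vanishes_hcomp by auto
  then show "n \<le> d"
    using vanishes_imp_multiple(1)[OF assms homogeneous_hcomp, of d f] by linarith
qed

lemma cspan_pscale:
  assumes "c \<noteq> 0"
  shows "cspan {pscale c f} = cspan {f}"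
proof -
  have "range (\<lambda>k. pscale k (pscale c f)) = range (\<lambda>k. pscale k f)"
  proof (intro equalityI subsetI)
    fix g assume "g \<in> range (\<lambda>k. pscale k f)"
    then obtain k where "g = pscale k f" by blast
    then have "g = pscale (k / c) (pscale c f)" using assms by simp
    then show "g \<in> range (\<lambda>k. pscale k (pscale c f))" by blast
  qed auto
  then show ?thesis by (simp add: cspan_singleton)
qed

text \<open>Each chosen form is a nonzero multiple of the normalized one, and the scalars combine
  into one nonzero factor.\<close>

lemma cspan_prod_defining_forms:
  assumes "\<forall>L\<in>boroczky_lines n. defines_line (l L) L"
  shows "cspan {\<Prod>L\<in>boroczky_lines n. l L} = cspan {lines_form n}"
proof -
  have "\<forall>j\<in>{..<n}. \<exists>c. c \<noteq> 0 \<and> l (line_of (ang n j)) = pconst c * ell (ang n j)"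
    using assms by (auto simp: boroczky_lines_eq intro!: defines_line_unique)
  then obtain c where c: "\<And>j. j < n \<Longrightarrow> c j \<noteq> 0 \<and> l (line_of (ang n j)) = pconst (c j) * ell (ang n j)"
    by (metis lessThan_iff)
  have "(\<Prod>L\<in>boroczky_lines n. l L) = (\<Prod>j<n. l (line_of (ang n j)))"
    unfolding boroczky_lines_eq by (simp add: prod.reindex inj_on_line_of_ang)
  also have "\<dots> = (\<Prod>j<n. pconst (c j) * ell (ang n j))"
    using c by (intro prod.cong) auto
  also have "\<dots> = pscale (\<Prod>j<n. c j) (lines_form n)"
    by (simp add: prod.distrib pscale_def lines_form_def)
  finally show ?thesis
    using c by (simp add: cspan_pscale)
qed

section \<open>Rotation and reflection matrices\<close>

definition rotm :: "real \<Rightarrow> complex^3^3" where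
  "rotm a = vector [vector [of_real (cos a), - of_real (sin a), 0],
     vector [of_real (sin a), of_real (cos a), 0], vector [0, 0, 1]]"

text \<open>Reflection of the plane in the axis through the origin at angle
  \<open>a / 2\<close>.\<close>

definition reflm :: "real \<Rightarrow> complex^3^3" where
  "reflm a = vector [vector [of_real (cos a), of_real (sin a), 0],
     vector [of_real (sin a), - of_real (cos a), 0], vector [0, 0, 1]]"

lemma rotm_mult: "rotm a ** rotm b = rotm (a + b)"
  and rotm_reflm_mult: "rotm a ** reflm b = reflm (a + b)"
  and reflm_rotm_mult: "reflm a ** rotm b = reflm (a - b)"
  and reflm_mult: "reflm a ** reflm b = rotm (a - b)"
  by (simp_all add: rotm_def reflm_def vec_eq_iff forall_3 matrix_matrix_mult_def sum_3
      cos_add sin_add cos_diff sin_diff algebra_simps)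

lemma rotm_0: "rotm 0 = mat 1"
  by (simp add: rotm_def mat_def vec_eq_iff forall_3)

lemma matrix_inv_eqI:
  fixes A :: "'a::semiring_1^'n^'n"
  assumes "A ** B = mat 1" and "B ** A = mat 1"
  shows "matrix_inv A = B"
proof -
  have "A ** matrix_inv A = mat 1 \<and> matrix_inv A ** A = mat 1"
    unfolding matrix_inv_def by (rule someI) (use assms in blast)
  then have "matrix_inv A = matrix_inv A ** (A ** B)" "(matrix_inv A ** A) ** B = B"
    by (simp_all add: assms matrix_mul_rid matrix_mul_lid)
  then show ?thesis by (simp add: matrix_mul_assoc)
qed

lemma matrix_inv_rotm: "matrix_inv (rotm a) = rotm (- a)"
  by (rule matrix_inv_eqI) (simp_all add: rotm_mult rotm_0)

lemma matrix_inv_reflm: "matrix_inv (reflm a) = reflm a"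
  by (rule matrix_inv_eqI) (simp_all add: reflm_mult rotm_0)

lemma invertible_rotm: "invertible (rotm a)"
  unfolding invertible_def by (rule exI[of _ "rotm (- a)"]) (simp add: rotm_mult rotm_0)

lemma invertible_reflm: "invertible (reflm a)"
  unfolding invertible_def by (rule exI[of _ "reflm a"]) (simp add: reflm_mult rotm_0)

section \<open>The action on the line forms\<close>

lemma ring_morphism_act: "ring_morphism (act g)"
  unfolding act_def psubst_eq_aeval by (rule ring_morphism_aeval[OF ring_morphism_pconst])

lemma act_pconst: "act g (pconst c) = pconst c"
  by (simp add: act_def psubst_eq_aeval ring_morphism_pconst)

text \<open>The action multiplies the coefficient row \<open>(sin t, cos t, - sin (3 * t))\<close>
  by the inverse matrix from the right.\<close>

lemma act_ell:
  fixes g :: "complex^3^3" and t :: real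
  defines "u j \<equiv> of_real (sin t) * matrix_inv g $ 1 $ j + of_real (cos t) * matrix_inv g $ 2 $ j
    - of_real (sin (3 * t)) * matrix_inv g $ 3 $ j"
  assumes "u 1 = of_real (sin t')" and "u 2 = of_real (cos t')" and "u 3 = - of_real (sin (3 * t'))"
  shows "act g (ell t) = ell t'"
proof -
  have collect: "s * (a1 * x + a2 * y + a3 * z) + c * (b1 * x + b2 * y + b3 * z) - d * (e1 * x + e2 * y + e3 * z) =
    (s * a1 + c * b1 - d * e1) * x + (s * a2 + c * b2 - d * e2) * y + (s * a3 + c * b3 - d * e3) * z"
    for s c d x y z a1 a2 a3 b1 b2 b3 e1 e2 e3 :: "'a::comm_ring_1"
    by (simp add: algebra_simps)
  have "act g (ell t) = pconst (u 1) * pvar 1 + pconst (u 2) * pvar 2 + pconst (u 3) * pvar 3"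
    unfolding act_def psubst_eq_aeval aeval_ell[OF ring_morphism_pconst] sum_3 collect u_def
      pconst.add pconst.diff pconst.mult ..
  then show ?thesis unfolding assms(2-4) by (simp add: ell_def)
qed

lemma sin_cos_shift:
  "sin (3 * (t - 2 * pi * of_int k / 3)) = sin (3 * t)"
  "sin (3 * (pi - t)) = sin (3 * t)"
proof -
  have "3 * (t - 2 * pi * of_int k / 3) = 3 * t - 2 * pi * of_int k" by simp
  then show "sin (3 * (t - 2 * pi * of_int k / 3)) = sin (3 * t)"
    by (simp only: sin_diff sin_int_2pin cos_int_2pin mult_zero_right mult_1_right diff_zero)
  have "3 * (pi - t) = pi - 3 * t + 2 * pi" by simp
  then have "sin (3 * (pi - t)) = sin (pi - 3 * t)" by (simp only: sin_periodic)
  then show "sin (3 * (pi - t)) = sin (3 * t)" by simp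
qed

lemma act_rotm_ell: "act (rotm (2 * pi * of_int k / 3)) (ell t) = ell (t - 2 * pi * of_int k / 3)"
  by (rule act_ell; unfold matrix_inv_rotm sin_cos_shift)
     (simp_all add: rotm_def sin_diff cos_diff algebra_simps)

lemma act_reflm_ell: "act (reflm (2 * pi * of_int k / 3)) (ell t) = ell (pi - t - 2 * pi * of_int k / 3)"
proof -
  let ?a = "2 * pi * of_int k / 3"
  have "sin (pi - t - ?a) = sin (t + ?a)" "cos (pi - t - ?a) = - cos (t + ?a)"
    by (simp_all add: diff_diff_eq cos_diff sin_diff)
  then show ?thesis
    by (intro act_ell; unfold matrix_inv_reflm sin_cos_shift)
       (simp_all add: reflm_def sin_add cos_add algebra_simps)
qed

text \<open>The product over \<open>n\<close> consecutive indices from \<open>m\<close> on. Integer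
  offsets allow shifts in both directions.\<close>

definition window :: "nat \<Rightarrow> int \<Rightarrow> poly3" where
  "window n m = (\<Prod>j<n. ell (pi * of_int (int j + m) / real n))"

lemma ell_add_pi: "ell (t + pi) = - ell t"
proof -
  have "3 * (t + pi) = 3 * t + pi + 2 * pi" by simp
  then have "sin (3 * (t + pi)) = - sin (3 * t)" by (simp only: sin_periodic) simp
  then show ?thesis by (simp add: ell_def algebra_simps)
qed

text \<open>The shift replaces the first factor by the same form at \<open>t + pi\<close>, its
  negative. Splitting the product of \<open>n + 1\<close> factors at either end shows this, after
  cancelling the nonzero first factor.\<close>

lemma window_step:
  assumes "n > 0"
  shows "window n (m + 1) = - window n m"
proof -
  let ?g = "\<lambda>j. ell (pi * of_int (int j + m) / real n)"
  have "window n (m + 1) = (\<Prod>j<n. ?g (Suc j))"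
    by (simp add: window_def algebra_simps)
  moreover have "(\<Prod>j<Suc n. ?g j) = ?g 0 * (\<Prod>j<n. ?g (Suc j))"
    by (rule prod.lessThan_Suc_shift)
  moreover have "(\<Prod>j<Suc n. ?g j) = (\<Prod>j<n. ?g j) * ?g n"
    by (rule prod.lessThan_Suc)
  moreover have "?g n = - ?g 0"
  proof -
    have "pi * of_int (int n + m) / real n = pi * of_int (int 0 + m) / real n + pi"
      using assms by (simp add: field_simps)
    then show ?thesis by (simp only: ell_add_pi)
  qed
  ultimately have "?g 0 * window n (m + 1) = window n m * - ?g 0"
    by (simp only: window_def)
  then have "?g 0 * window n (m + 1) = ?g 0 * (- window n m)"
    by (simp add: mult.commute)
  then show ?thesis by (rule mult_left_cancel[OF ell_neq_0, THEN iffD1])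
qed

lemma window_even:
  assumes "n > 0"
  shows "window n (2 * k) = lines_form n"
proof (induction k rule: int_induct[of _ 0])
  case base
  show ?case by (simp add: window_def lines_form_def)
next
  case (step1 k)
  have "2 * (k + 1) = 2 * k + 1 + 1" by simp
  then have "window n (2 * (k + 1)) = window n (2 * k + 1 + 1)" by (simp only:)
  with step1(2) show ?case by (simp only: window_step[OF assms]) simp
next
  case (step2 k)
  have "2 * k = 2 * (k - 1) + 1 + 1" by simp
  then have "window n (2 * k) = window n (2 * (k - 1) + 1 + 1)" by (simp only:)
  with step2(2) show ?case by (simp only: window_step[OF assms]) simp
qed

text \<open>With \<open>n = 3 * m\<close>, a third turn shifts indices by \<open>2 * m\<close>, an
  even number, so no sign arises from rotations.\<close>

lemma act_lines_form:
  assumes "12 \<le> n" and "6 dvd n"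
  shows "act (rotm (2 * pi * of_int k / 3)) (lines_form n) = lines_form n"
    and "act (reflm (2 * pi * of_int k / 3)) (lines_form n) = - lines_form n"
proof -
  interpret act: ring_morphism "act g" for g by (rule ring_morphism_act)
  have n: "n > 0" using assms by simp
  obtain m where m: "n = 3 * m" using assms(2) by (auto elim!: dvdE)
  have shift: "pi * real j / real n - 2 * pi * of_int k / 3 = pi * of_int (int j + 2 * (- int m * k)) / real n" for j
    using n by (simp add: m field_simps)
  have "act (rotm (2 * pi * of_int k / 3)) (lines_form n) = window n (2 * (- int m * k))"
    unfolding lines_form_def window_def by (simp only: act.prod act_rotm_ell shift)
  then show "act (rotm (2 * pi * of_int k / 3)) (lines_form n) = lines_form n"
    by (simp only: window_even[OF n])
  \<comment> \<open>Reversing the product turns index \<open>j\<close> into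
    \<open>n - 1 - j\<close>, which the reflection sends to \<open>j + 1\<close> up to an even
    shift; this extra 1 produces the sign.\<close>
  have shift': "pi - pi * real (n - Suc j) / real n - 2 * pi * of_int k / 3 =
      pi * of_int (int j + (2 * (- int m * k) + 1)) / real n" if "j < n" for j
    using that by (simp add: of_nat_diff m field_simps)
  have "act (reflm (2 * pi * of_int k / 3)) (lines_form n) =
      (\<Prod>j<n. ell (pi - pi * real j / real n - 2 * pi * of_int k / 3))"
    unfolding lines_form_def by (simp only: act.prod act_reflm_ell)
  also have "\<dots> = (\<Prod>j<n. ell (pi - pi * real (n - Suc j) / real n - 2 * pi * of_int k / 3))"
    by (rule prod.nat_diff_reindex[symmetric])
  also have "\<dots> = window n (2 * (- int m * k) + 1)"
    unfolding window_def using shift' by (intro prod.cong) auto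
  also have "\<dots> = - lines_form n"
    by (simp only: window_step[OF n] window_even[OF n])
  finally show "act (reflm (2 * pi * of_int k / 3)) (lines_form n) = - lines_form n" .
qed

section \<open>The elements of the dihedral group\<close>

lemma rot_mat_eq: "rot_mat = rotm (2 * pi * of_int 1 / 3)"
  by (simp add: rot_mat_def rotm_def Let_def)

lemma refl_mat_eq: "refl_mat = reflm (2 * pi * of_int 0 / 3)"
  by (simp add: refl_mat_def reflm_def)

lemma group_GL3: "group GL3"
proof (rule groupI)
  fix A assume "A \<in> carrier GL3"
  then obtain B where "A ** B = mat 1" "B ** A = mat 1"
    by (auto simp: GL3_def invertible_def)
  then show "\<exists>B\<in>carrier GL3. B \<otimes>\<^bsub>GL3\<^esub> A = \<one>\<^bsub>GL3\<^esub>"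
    by (intro bexI[of _ B]) (auto simp: GL3_def invertible_def)
qed (auto simp: GL3_def invertible_mult matrix_mul_assoc matrix_mul_lid invertible_rotm[of 0, unfolded rotm_0])

lemma inv_GL3_rotm: "inv\<^bsub>GL3\<^esub> (rotm a) = rotm (- a)"
  by (rule group.inv_equality[OF group_GL3])
     (simp_all add: GL3_def rotm_mult rotm_0 invertible_rotm)

lemma inv_GL3_reflm: "inv\<^bsub>GL3\<^esub> (reflm a) = reflm a"
  by (rule group.inv_equality[OF group_GL3])
     (simp_all add: GL3_def reflm_mult rotm_0 invertible_reflm)

text \<open>Needed to conclude that an element of \<open>D6\<close> outside
  \<open>D6_rotations\<close> is a reflection.\<close>

lemma rotm_in_D6_rotations: "rotm (2 * pi * of_int k / 3) \<in> D6_rotations"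
proof (induction k rule: int_induct[of _ 0])
  case base
  show ?case using generate.one[of GL3] by (simp add: D6_rotations_def GL3_def rotm_0)
next
  case (step1 k)
  have "rotm (2 * pi * of_int (k + 1) / 3) = rotm (2 * pi * of_int k / 3) \<otimes>\<^bsub>GL3\<^esub> rot_mat"
    by (simp add: GL3_def rot_mat_eq rotm_mult add_divide_distrib distrib_left)
  then show ?case
    using step1(2) generate.incl[of rot_mat "{rot_mat}" GL3] unfolding D6_rotations_def
    by (metis generate.eng singletonI)
next
  case (step2 k)
  have "rotm (2 * pi * of_int (k - 1) / 3) = rotm (2 * pi * of_int k / 3) \<otimes>\<^bsub>GL3\<^esub> inv\<^bsub>GL3\<^esub> rot_mat"
    unfolding rot_mat_eq inv_GL3_rotm
    by (simp add: GL3_def rotm_mult diff_divide_distrib right_diff_distrib)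
  then show ?case
    using step2(2) generate.inv[of rot_mat "{rot_mat}" GL3] unfolding D6_rotations_def
    by (metis generate.eng singletonI)
qed

lemma third_turns:
  "2 * pi * of_int k / 3 + 2 * pi * of_int l / 3 = 2 * pi * of_int (k + l) / 3"
  "2 * pi * of_int k / 3 - 2 * pi * of_int l / 3 = 2 * pi * of_int (k - l) / 3"
  "- (2 * pi * of_int k / 3) = 2 * pi * of_int (- k) / 3"
  by (simp_all add: field_simps)

lemma D6_rotations_cases:
  assumes "g \<in> D6_rotations"
  shows "\<exists>k::int. g = rotm (2 * pi * of_int k / 3)"
  using assms unfolding D6_rotations_def
proof (induction g rule: generate.induct)
  case one
  show ?case by (rule exI[of _ 0]) (simp add: GL3_def rotm_0)
next
  case (incl h)
  then show ?case using rot_mat_eq by blast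
next
  case (inv h)
  then have "inv\<^bsub>GL3\<^esub> h = rotm (2 * pi * of_int (- 1) / 3)"
    by (simp only: singleton_iff rot_mat_eq inv_GL3_rotm third_turns)
  then show ?case by blast
next
  case (eng g h)
  then show ?case by (auto simp add: GL3_def rotm_mult third_turns simp del: of_int_add)
qed

text \<open>These matrices include the generators and their inverses and are closed under
  products.\<close>

lemma D6_cases:
  assumes "g \<in> D6"
  shows "\<exists>k::int. g = rotm (2 * pi * of_int k / 3) \<or> g = reflm (2 * pi * of_int k / 3)"
  using assms unfolding D6_def
proof (induction g rule: generate.induct)
  case one
  show ?case by (rule exI[of _ 0]) (simp add: GL3_def rotm_0)
next
  case (incl h)
  then show ?case using rot_mat_eq refl_mat_eq by blast
next
  case (inv h)
  then have "inv\<^bsub>GL3\<^esub> h = rotm (2 * pi * of_int (- 1) / 3) \<or> inv\<^bsub>GL3\<^esub> h = reflm (2 * pi * of_int 0 / 3)"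
    using inv_GL3_rotm inv_GL3_reflm rot_mat_eq refl_mat_eq third_turns(3) by (metis insertE singletonD)
  then show ?case by blast
next
  case (eng g h)
  then obtain k l where
    "g = rotm (2 * pi * of_int k / 3) \<or> g = reflm (2 * pi * of_int k / 3)"
    "h = rotm (2 * pi * of_int l / 3) \<or> h = reflm (2 * pi * of_int l / 3)"
    by blast
  then show ?case
    unfolding GL3_def monoid.simps
    by (elim disjE) (simp_all only: rotm_mult rotm_reflm_mult reflm_rotm_mult reflm_mult third_turns, blast+)
qed

theorem proposition4p8:
  fixes n :: nat
  assumes "12 \<le> n" and "6 dvd n"
  shows "let J = symbolic_power (triple_points n) 3; V = graded_piece n J in
    alpha J = n \<and>
    cdim V = 1 \<and>
    (\<forall>l. (\<forall>L\<in>boroczky_lines n. defines_line (l L) L) \<longrightarrow>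
       V = cspan {\<Prod>L\<in>boroczky_lines n. l L}) \<and>
    (\<forall>f\<in>V. (\<forall>g\<in>D6_rotations. act g f = f) \<and> (\<forall>g\<in>D6 - D6_rotations. act g f = - f))"
  unfolding Let_def graded_piece_eq[OF assms]
proof (intro conjI allI impI ballI)
  show "alpha (symbolic_power (triple_points n) 3) = n" by (rule alpha_eq[OF assms])
  show "cdim (cspan {lines_form n}) = 1"
    using lines_form_neq_0
    by (simp add: cvec.dim_span cvec.dim_eq_card_independent cvec.independent_insert cvec.independent_empty)
next
  fix l assume "\<forall>L\<in>boroczky_lines n. defines_line (l L) L"
  then show "cspan {lines_form n} = cspan {\<Prod>L\<in>boroczky_lines n. l L}"
    by (simp add: cspan_prod_defining_forms)
next
  fix f g assume "f \<in> cspan {lines_form n}" and g: "g \<in> D6_rotations"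
  then obtain c where f: "f = pscale c (lines_form n)" by (auto simp: cspan_singleton)
  interpret act: ring_morphism "act g" by (rule ring_morphism_act)
  from D6_rotations_cases[OF g] show "act g f = f"
    by (auto simp: f pscale_def act_pconst act_lines_form(1)[OF assms])
next
  fix f g assume "f \<in> cspan {lines_form n}" and g: "g \<in> D6 - D6_rotations"
  then obtain c where f: "f = pscale c (lines_form n)" by (auto simp: cspan_singleton)
  interpret act: ring_morphism "act g" by (rule ring_morphism_act)
  \<comment> \<open>All rotations by third turns lie in \<open>D6_rotations\<close>, so only the
    reflection case survives.\<close>
  obtain k :: int where k: "g = reflm (2 * pi * of_int k / 3)"
    using D6_cases[of g] g rotm_in_D6_rotations by blast
  have "act g f = pconst c * act g (lines_form n)"
    by (simp add: f pscale_def act_pconst)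
  then show "act g f = - f"
    by (simp add: f pscale_def k act_lines_form(2)[OF assms])
qed

end
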